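(* Let $\Omega\subset\mathbb{R}^d$ be a (Lebesgue measurable) set of positive and finite measure. Then for any $1<p<+\infty$ there exists an unconditional Schauder frame $\{(g_n, g_n^* )\}_{n=1}^{\infty}$ in the space $L^p(\Omega)$ such that the functions $g_n$ are unimodular, i.e. for every $n$ we have $|g_n(x)| = 1$ for almost every $x\in\Omega$.
   Context: $L^p(\Omega)$ is the space of complex-valued $p$-integrable functions on $\Omega$ with respect to Lebesgue measure. If $X$ is a separable Banach space with dual space $X^*$, a system $\{(u_n,u_n^* )\}_{n=1}^\infty\subset X\times X^*$ is called a Schauder frame if every $x\in X$ admits the series expansion $x=\sum_{n=1}^\infty u_n^*(x)u_n$ (convergent in the norm of $X$). It is called an unconditional Schauder frame if moreover this series converges unconditionally (i.e. for every rearrangement of its terms) for every $x\in X$. *)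

theory Defs
  imports "HOL-Analysis.Analysis"
begin

text \<open>
  Elements of \<open>L\<^sup>p(M)\<close> are represented by functions rather than by classes of functions modulo
  equality almost everywhere, so \<open>Lp_norm\<close> is a seminorm on the representatives, which vanishes
  exactly on the functions that are zero almost everywhere. The definitions below are used for
  \<open>1 \<le> p < \<infinity>\<close>.
\<close>

definition Lp_space :: "real \<Rightarrow> 'a measure \<Rightarrow> ('a \<Rightarrow> complex) set" where
  "Lp_space p M =
     {f. f \<in> borel_measurable M \<and> integrable M (\<lambda>x. norm (f x) powr p)}"

definition Lp_norm :: "real \<Rightarrow> 'a measure \<Rightarrow> ('a \<Rightarrow> complex) \<Rightarrow> real" where
  "Lp_norm p M f = (LINT x|M. norm (f x) powr p) powr (1 / p)"

text \<open>
  The boundedness condition forces a functional to take equal values on functions that agree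
  almost everywhere, so it descends to the quotient. Its values outside \<open>Lp_space p M\<close> are
  irrelevant.
\<close>

definition Lp_dual :: "real \<Rightarrow> 'a measure \<Rightarrow> (('a \<Rightarrow> complex) \<Rightarrow> complex) set" where
  "Lp_dual p M = {\<phi>.
     (\<forall>f\<in>Lp_space p M. \<forall>h\<in>Lp_space p M. \<phi> (\<lambda>x. f x + h x) = \<phi> f + \<phi> h) \<and>
     (\<forall>c. \<forall>f\<in>Lp_space p M. \<phi> (\<lambda>x. c * f x) = c * \<phi> f) \<and>
     (\<exists>C. \<forall>f\<in>Lp_space p M. norm (\<phi> f) \<le> C * Lp_norm p M f)}"

definition Lp_sums ::
    "real \<Rightarrow> 'a measure \<Rightarrow> (nat \<Rightarrow> 'a \<Rightarrow> complex) \<Rightarrow> ('a \<Rightarrow> complex) \<Rightarrow> bool" where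
  "Lp_sums p M t s \<longleftrightarrow> (\<lambda>N. Lp_norm p M (\<lambda>x. (\<Sum>n<N. t n x) - s x)) \<longlonglongrightarrow> 0"

definition Lp_unconditionally_convergent ::
    "real \<Rightarrow> 'a measure \<Rightarrow> (nat \<Rightarrow> 'a \<Rightarrow> complex) \<Rightarrow> bool" where
  "Lp_unconditionally_convergent p M t \<longleftrightarrow>
     (\<forall>\<sigma>::nat \<Rightarrow> nat. bij \<sigma> \<longrightarrow> (\<exists>s\<in>Lp_space p M. Lp_sums p M (\<lambda>n. t (\<sigma> n)) s))"

definition schauder_frame ::
    "real \<Rightarrow> 'a measure \<Rightarrow> (nat \<Rightarrow> 'a \<Rightarrow> complex) \<Rightarrow> (nat \<Rightarrow> ('a \<Rightarrow> complex) \<Rightarrow> complex) \<Rightarrow> bool" where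
  "schauder_frame p M u \<phi> \<longleftrightarrow>
     (\<forall>n. u n \<in> Lp_space p M) \<and> (\<forall>n. \<phi> n \<in> Lp_dual p M) \<and>
     (\<forall>f\<in>Lp_space p M. Lp_sums p M (\<lambda>n x. \<phi> n f * u n x) f)"

definition unconditional_schauder_frame ::
    "real \<Rightarrow> 'a measure \<Rightarrow> (nat \<Rightarrow> 'a \<Rightarrow> complex) \<Rightarrow> (nat \<Rightarrow> ('a \<Rightarrow> complex) \<Rightarrow> complex) \<Rightarrow> bool" where
  "unconditional_schauder_frame p M u \<phi> \<longleftrightarrow>
     schauder_frame p M u \<phi> \<and>
     (\<forall>f\<in>Lp_space p M. Lp_unconditionally_convergent p M (\<lambda>n x. \<phi> n f * u n x))"

end

theory Submission imports Defs begin

text \<open>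
  The idea is to take an unconditional basis of Haar type consisting of real functions bounded by
  \<open>1\<close>, and to replace each basis function by many unimodular functions whose average it is. Two
  properties have to be arranged: unconditionality of the Haar expansion, which is where
  \<open>1 < p < \<infinity>\<close> enters, and the fact that an average over only some of the unimodular functions
  is still almost a multiple of the basis function.

  \<^bold>\<open>The basis.\<close> Splitting the domain successively by the sets of a countable topological basis gives
  a binary tree of cells. The function \<open>h\<^sub>k\<close> lives on the \<open>k\<close>-th cell, takes one value on each of its
  two children and has mean zero; \<open>h\<^sub>0 = 1\<close>. An earlier function is constant on the support of a
  later one, so the system is orthogonal and \<open>\<Sum>\<^sub>k a\<^sub>k h\<^sub>k\<close> is a martingale. Every Lebesgue measurable
  set is approximated in measure by finite unions of basic open sets, so finite combinations of the
  \<open>h\<^sub>k\<close> are dense (\<open>haar_dense\<close>).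

  \<^bold>\<open>Unconditionality.\<close> Burkholder's function \<open>U(x,y) = (|y| - K|x|) (|x| + |y|)\<^sup>p\<^sup>-\<^sup>1\<close> is concave along
  all lines of slope \<open>\<plusminus>1\<close>, it is nonpositive on the diagonals, and \<open>|y|\<^sup>p \<le> C|x|\<^sup>p + 2 U(x,y)\<close>.
  If \<open>X\<^sub>n\<close> is a partial sum of \<open>\<Sum>\<^sub>k a\<^sub>k h\<^sub>k\<close> and \<open>Y\<^sub>n\<close> the same sum with changed signs, then each step
  moves \<open>(X\<^sub>n, Y\<^sub>n)\<close> along such a line by a quantity of mean zero, so the integral of \<open>U(X\<^sub>n, Y\<^sub>n)\<close>
  does not increase and stays nonpositive. Hence sign changes are bounded in \<open>L\<^sup>p\<close>, and so are
  restrictions of the expansion of \<open>f\<close> to subsets (\<open>partial_sum_bound\<close>) and, by convexity,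
  multipliers \<open>0 \<le> \<lambda>\<^sub>k \<le> 1\<close>.

  \<^bold>\<open>Unimodular averages.\<close> A real function \<open>u\<close> with \<open>|u| \<le> 1\<close> is the average of the unimodular functions
  \<open>u + \<i> \<rho>\<^sub>i sqrt (1 - u\<^sup>2)\<close>, where the signs \<open>\<rho>\<^sub>i\<close> run through \<open>r\<^sub>1, ..., r\<^sub>m, -r\<^sub>1, ..., -r\<^sub>m\<close>. If the
  \<open>r\<^sub>j\<close> are orthogonal with respect to the weight \<open>1 - u\<^sup>2\<close>, as Rademacher functions are, then the
  sum of any part of the family, divided by the size of the whole family, differs from a multiple
  of \<open>u\<close> by \<open>O(m\<^sup>-\<^sup>1\<^sup>/\<^sup>2)\<close> in \<open>L\<^sup>2\<close>; the difference is bounded by \<open>1\<close>, so it is small in \<open>L\<^sup>p\<close> too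
  (\<open>unimodular_average\<close>).

  \<^bold>\<open>The frame.\<close> Write each \<open>h\<^sub>k\<close> as the average of \<open>N\<^sub>k\<close> unimodular functions \<open>v\<^sub>k\<^sub>,\<^sub>i\<close>, with \<open>N\<^sub>k\<close> so large
  that the errors are summable against the norms of the coefficient functionals \<open>c\<^sub>k\<close>, and expand
  \<open>f\<close> into the terms \<open>(c\<^sub>k(f) / N\<^sub>k) v\<^sub>k\<^sub>,\<^sub>i\<close>. A finite sum of such terms is \<open>\<Sum>\<^sub>k \<lambda>\<^sub>k c\<^sub>k(f) h\<^sub>k\<close> with
  \<open>0 \<le> \<lambda>\<^sub>k \<le> 1\<close> up to an error of norm at most \<open>2 \<parallel>f\<parallel>\<close>, so all finite sums are bounded uniformly.
  On a finite combination of the \<open>h\<^sub>k\<close> the sum equals \<open>f\<close> once finitely many indices are included. By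
  density the finite sums converge to \<open>f\<close> along the directed set of finite index sets, which gives
  convergence in every order (\<open>unimodular_unconditional_frame\<close>).
\<close>

section \<open>Burkholder's function\<close>

lemma convex_on_powr_nonneg:
  fixes p :: real
  assumes "p \<ge> 1"
  shows "convex_on {0..} (\<lambda>x::real. x powr p)"
proof (intro convex_onI)
  fix t x y :: real
  assume t: "t > 0" "t < 1" and xy: "x \<in> {0..}" "y \<in> {0..}"
  have *: "(s * z) powr p \<le> s * z powr p" if "0 < s" "s < 1" "0 \<le> z" for s z :: real
  proof -
    have "s powr p \<le> s powr 1" using that assms by (intro powr_mono') auto
    then show ?thesis using that by (simp add: powr_mult mult_right_mono)
  qed
  show "((1 - t) *\<^sub>R x + t *\<^sub>R y) powr p \<le> (1 - t) * x powr p + t * y powr p"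
  proof (cases "x = 0 \<or> y = 0")
    case True
    then show ?thesis using *[of t y] *[of "1 - t" x] t xy assms by auto
  next
    case False
    then show ?thesis
      using convex_onD[OF powr_convex[OF assms], of t x y] t xy by auto
  qed
qed auto

text \<open>
  For \<open>K = max (p - 1) (1 / (p - 1))\<close> this is, up to a factor, the function from Burkholder's sharp
  inequality for martingale transforms. All that is asked of \<open>K\<close> below is that \<open>1 \<le> K\<close> and
  \<open>\<bar>p - 2\<bar> * (K + 1) \<le> p * (K - 1)\<close>, which makes the function concave along the lines of slope
  \<open>\<plusminus>1\<close> for \<open>p < 2\<close> and for \<open>p > 2\<close> alike; such a \<open>K\<close> exists because \<open>\<bar>p - 2\<bar> < p\<close>.
\<close>

definition burkholder :: "real \<Rightarrow> real \<Rightarrow> real \<Rightarrow> real \<Rightarrow> real" where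
  "burkholder p K x y = (\<bar>y\<bar> - K * \<bar>x\<bar>) * (\<bar>x\<bar> + \<bar>y\<bar>) powr (p - 1)"

text \<open>
  Composing a concave nonincreasing function with the convex function \<open>max\<close> keeps concavity. This is
  how a concave piece given on a half-line is glued to a constant without discussing one-sided slopes.
\<close>

lemma concave_on_compose_max:
  fixes R :: "real \<Rightarrow> real"
  assumes R: "concave_on {d..} R" and dec: "\<And>a b. d \<le> a \<Longrightarrow> a \<le> b \<Longrightarrow> R b \<le> R a"
  shows "concave_on UNIV (\<lambda>s. R (max s d))"
  unfolding concave_on_iff
proof (intro conjI ballI allI impI)
  fix x y u v :: real
  assume uv: "0 \<le> u" "0 \<le> v" "u + v = 1"
  have d: "u * d + v * d = d" using uv by (metis distrib_right mult_1)
  have "u * max x d + v * max y d \<ge> u * d + v * d"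
    by (intro add_mono mult_left_mono) (use uv in auto)
  moreover have "u * max x d + v * max y d \<ge> u * x + v * y"
    by (intro add_mono mult_left_mono) (use uv in auto)
  ultimately have le: "max (u * x + v * y) d \<le> u * max x d + v * max y d" using d by simp
  have "u * R (max x d) + v * R (max y d) \<le> R (u *\<^sub>R max x d + v *\<^sub>R max y d)"
    using R uv unfolding concave_on_iff by simp
  also have "\<dots> \<le> R (max (u *\<^sub>R x + v *\<^sub>R y) d)"
    using le by (intro dec) auto
  finally show "u * R (max x d) + v * R (max y d) \<le> R (max (u *\<^sub>R x + v *\<^sub>R y) d)" .
qed simp

text \<open>
  Along the line \<open>s \<mapsto> (s + d, s - d)\<close> Burkholder's function is affine for \<open>\<bar>s\<bar> \<le> d\<close>. Here \<open>R\<close> is what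
  has to be added to this affine function beyond \<open>s = d\<close> (for \<open>e = 1\<close>) or, after reflection, before
  \<open>s = -d\<close> (for \<open>e = -1\<close>). The condition on \<open>K\<close> says that the slope of \<open>R\<close> at \<open>d\<close> is nonpositive in
  both cases; it also gives the sign of the second derivative.
\<close>

lemma burkholder_branch:
  fixes p K d e :: real
  assumes p: "1 < p" and K: "1 \<le> K" "\<bar>p - 2\<bar> * (K + 1) \<le> p * (K - 1)"
    and d: "0 \<le> d" and e: "\<bar>e\<bar> = 1"
  defines "R \<equiv> \<lambda>s. (1 - K) * s powr p - e * (1 + K) * d * s powr (p - 1)
              - d powr (p - 1) * ((1 - K) * d - e * (1 + K) * s)"
  shows "concave_on {d..} R" "\<And>a b. d \<le> a \<Longrightarrow> a \<le> b \<Longrightarrow> R b \<le> R a"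
proof -
  have "concave_on {d..} R \<and> (\<forall>a b. d \<le> a \<longrightarrow> a \<le> b \<longrightarrow> R b \<le> R a)"
  proof (cases "d = 0")
    case True
    have R: "R = (\<lambda>s. - ((K - 1) * s powr p))" using p True by (auto simp: R_def algebra_simps)
    have "convex_on {0..} (\<lambda>s. (K - 1) * s powr p)"
      using convex_on_powr_nonneg[of p] p K by (intro convex_on_cmul) auto
    then have "concave_on {d..} R" unfolding R True concave_on_def by simp
    moreover have "R b \<le> R a" if "d \<le> a" "a \<le> b" for a b
      unfolding R using that True K p by (auto intro!: mult_left_mono powr_mono2)
    ultimately show ?thesis by auto
  next
    case False
    with d have d: "d > 0" by simp
    define R' where "R' = (\<lambda>s. (1 - K) * p * s powr (p - 1) - e * (1 + K) * d * (p - 1) * s powr (p - 2)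
              + e * (1 + K) * d powr (p - 1))"
    define R'' where "R'' = (\<lambda>s. (1 - K) * p * (p - 1) * s powr (p - 2)
             - e * (1 + K) * d * (p - 1) * (p - 2) * s powr (p - 3))"
    have D1: "(R has_real_derivative R' s) (at s)" if "d \<le> s" for s
      unfolding R_def R'_def using that d
      by (auto intro!: derivative_eq_intros simp: algebra_simps)
    have D2: "(R' has_real_derivative R'' s) (at s)" if "d \<le> s" for s
      unfolding R'_def R''_def using that d
      by (auto intro!: derivative_eq_intros simp: algebra_simps)
    have key: "- e * (1 + K) * (p - 2) \<le> p * (K - 1)"
    proof -
      have "- e * (p - 2) \<le> \<bar>- e * (p - 2)\<bar>" by (rule abs_ge_self)
      also have "\<dots> = \<bar>p - 2\<bar>" using e by (simp add: abs_mult)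
      finally have "(- e * (p - 2)) * (K + 1) \<le> \<bar>p - 2\<bar> * (K + 1)"
        using K by (intro mult_right_mono) auto
      with K show ?thesis by (simp add: algebra_simps)
    qed
    have N2: "R'' s \<le> 0" if s: "d \<le> s" for s
    proof -
      have "- e * (1 + K) * (p - 2) * d \<le> p * (K - 1) * s"
      proof (cases "- e * (1 + K) * (p - 2) \<le> 0")
        case True
        then have "- e * (1 + K) * (p - 2) * d \<le> 0" using d mult_nonpos_nonneg[of _ d] by simp
        also have "0 \<le> p * (K - 1) * s" using p K d s by auto
        finally show ?thesis .
      next
        case False
        have "0 \<le> p * (K - 1)" using p K by simp
        then show ?thesis using d by (intro mult_mono[OF key s]) simp_all
      qed
      then have "(p - 1) * s powr (p - 3) * ((1 - K) * p * s - e * (1 + K) * (p - 2) * d) \<le> 0"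
        using p by (intro mult_nonneg_nonpos mult_nonneg_nonneg) (auto simp: algebra_simps)
      moreover have "s powr (p - 2) = s powr (p - 3) * s"
        using s d powr_add[of s "p - 3" 1] by simp
      ultimately show ?thesis unfolding R''_def by (simp add: algebra_simps)
    qed
    have N1: "R' s \<le> 0" if s: "d \<le> s" for s
    proof -
      have "R' s \<le> R' d"
      proof (rule DERIV_nonpos_imp_nonincreasing[OF s])
        show "\<exists>y. (R' has_real_derivative y) (at z) \<and> y \<le> 0" if "d \<le> z" for z
          using D2[OF that] N2[OF that] by blast
      qed
      also have "R' d = d powr (p - 1) * ((1 - K) * p - e * (1 + K) * (p - 2))"
      proof -
        have "d powr (p - 1) = d powr (p - 2) * d"
          using d powr_add[of d "p - 2" 1] by simp
        then show ?thesis unfolding R'_def by (simp add: algebra_simps)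
      qed
      also have "\<dots> \<le> 0" using key by (intro mult_nonneg_nonpos) (auto simp: algebra_simps)
      finally show ?thesis .
    qed
    have "concave_on {d..} R"
      using D1 D2 N2 by (intro f''_le0_imp_concave[where f' = R' and f'' = R'']) auto
    moreover have "R b \<le> R a" if "d \<le> a" "a \<le> b" for a b
    proof (rule DERIV_nonpos_imp_nonincreasing[OF that(2)])
      show "\<exists>y. (R has_real_derivative y) (at z) \<and> y \<le> 0" if "a \<le> z" for z
        using D1[of z] N1[of z] \<open>d \<le> a\<close> that by auto
    qed
    ultimately show ?thesis by blast
  qed
  then show "concave_on {d..} R" "\<And>a b. d \<le> a \<Longrightarrow> a \<le> b \<Longrightarrow> R b \<le> R a" by auto
qed

text \<open>
  With \<open>x = s + d\<close> and \<open>y = s - d\<close> one has \<open>\<bar>x\<bar> + \<bar>y\<bar> = 2 * max \<bar>s\<bar> d\<close>, so there are three regimes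
  of \<open>s\<close>; both outer ones are corrections of the affine middle one that vanish on its end points.
\<close>

lemma concave_on_burkholder:
  fixes p K d :: real
  assumes p: "1 < p" and K: "1 \<le> K" "\<bar>p - 2\<bar> * (K + 1) \<le> p * (K - 1)" and d: "0 \<le> d"
  shows "concave_on UNIV (\<lambda>s. burkholder p K (s + d) (s - d))"
proof -
  define L where "L s = d powr (p - 1) * ((1 - K) * d - (1 + K) * s)" for s
  define R where "R e = (\<lambda>s. (1 - K) * s powr p - e * (1 + K) * d * s powr (p - 1)
              - d powr (p - 1) * ((1 - K) * d - e * (1 + K) * s))" for e
  have pw: "s powr p = s * s powr (p - 1)" if "s \<ge> 0" for s :: real
    using that p powr_mult_base[of s "p - 1"] by simp
  have R0: "R e d = 0" for e unfolding R_def using pw[OF d] by (simp add: algebra_simps)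
  have eq: "burkholder p K (s + d) (s - d) =
      2 powr (p - 1) * (L s + R 1 (max s d) + R (- 1) (max (- s) d))" for s
  proof -
    consider "\<bar>s\<bar> \<le> d" | "s > d" | "- s > d" by linarith
    then show ?thesis
    proof cases
      case 1
      then have "max s d = d" "max (- s) d = d" by auto
      moreover have "\<bar>s + d\<bar> = s + d" "\<bar>s - d\<bar> = d - s" using 1 by auto
      ultimately show ?thesis using d
        by (simp add: burkholder_def R0 L_def powr_mult algebra_simps)
    next
      case 2
      then have "max s d = s" "max (- s) d = d" using d by auto
      moreover have "\<bar>s + d\<bar> = s + d" "\<bar>s - d\<bar> = s - d" using 2 d by auto
      moreover have "s \<ge> 0" using 2 d by auto
      ultimately show ?thesis using pw[of s]
        by (simp add: burkholder_def R0) (simp add: R_def L_def powr_mult algebra_simps)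
    next
      case 3
      then have "max s d = d" "max (- s) d = - s" using d by auto
      moreover have "\<bar>s + d\<bar> = - (s + d)" "\<bar>s - d\<bar> = d - s" using 3 d by auto
      moreover have "- s \<ge> 0" using 3 d by auto
      moreover have "-(s + d) + (d - s) = 2 * (- s)" by simp
      ultimately show ?thesis using pw[of "- s"] powr_mult[of 2 "-s" "p - 1"]
        by (simp only: burkholder_def R0) (simp add: R_def L_def algebra_simps)
    qed
  qed
  have "concave_on UNIV L" unfolding concave_on_iff L_def
  proof (intro conjI ballI allI impI)
    fix x y u v :: real assume "u + v = 1"
    then have v: "v = 1 - u" by simp
    show "u * (d powr (p - 1) * ((1 - K) * d - (1 + K) * x)) + v * (d powr (p - 1) * ((1 - K) * d - (1 + K) * y))
       \<le> d powr (p - 1) * ((1 - K) * d - (1 + K) * (u *\<^sub>R x + v *\<^sub>R y))"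
      unfolding v by (simp add: algebra_simps)
  qed simp
  moreover have c: "concave_on UNIV (\<lambda>s. R e (max s d))" if "\<bar>e\<bar> = 1" for e
    using burkholder_branch[OF p K d that] unfolding R_def by (intro concave_on_compose_max) auto
  moreover have "concave_on UNIV (\<lambda>s. R (-1) (max (- s) d))"
    unfolding concave_on_iff
  proof (intro conjI ballI allI impI)
    fix x y u v :: real assume uv: "0 \<le> u" "0 \<le> v" "u + v = 1"
    have "u * R (-1) (max (- x) d) + v * R (-1) (max (- y) d)
      \<le> R (-1) (max (u *\<^sub>R (- x) + v *\<^sub>R (- y)) d)"
      using c[of "-1"] uv unfolding concave_on_iff by (metis UNIV_I abs_minus_cancel abs_one)
    then show "u * R (-1) (max (- x) d) + v * R (-1) (max (- y) d)
      \<le> R (-1) (max (- (u *\<^sub>R x + v *\<^sub>R y)) d)" by simp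
  qed simp
  ultimately have "concave_on UNIV (\<lambda>s. L s + R 1 (max s d) + R (- 1) (max (- s) d))"
    using c[of 1] by (intro concave_on_add) auto
  then show ?thesis unfolding eq by (intro concave_on_cmul) auto
qed

lemma supporting_line:
  fixes \<phi> :: "real \<Rightarrow> real"
  assumes "concave_on UNIV \<phi>"
  shows "\<exists>m. \<forall>t. \<phi> (s + t) \<le> \<phi> s + m * t"
proof -
  define g where "g = Inf ((\<lambda>t. (- \<phi> s - - \<phi> t) / (s - t)) ` ({s<..} \<inter> UNIV))"
  have "- \<phi> y \<ge> - \<phi> s + g * (y - s)" for y
    unfolding g_def using assms by (intro convex_le_Inf_differential) (auto simp: concave_on_def)
  from this[of "s + _"] show ?thesis by (intro exI[of _ "-g"]) (auto simp: algebra_simps)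
qed

lemma burkholder_supporting_line:
  fixes p K x y e :: real
  assumes p: "1 < p" and K: "1 \<le> K" "\<bar>p - 2\<bar> * (K + 1) \<le> p * (K - 1)" and e: "\<bar>e\<bar> = 1"
  shows "\<exists>m. \<forall>t. burkholder p K (x + t) (y + e * t) \<le> burkholder p K x y + m * t"
proof -
  have *: "\<exists>m. \<forall>t. burkholder p K (x + t) (y + t) \<le> burkholder p K x y + m * t" for x y
  proof -
    define s d where "s = (x + y) / 2" and "d = (x - y) / 2"
    have xy: "x = s + d" "y = s - d" by (auto simp: s_def d_def field_simps)
    show ?thesis
    proof (cases "d \<ge> 0")
      case True
      from supporting_line[OF concave_on_burkholder[OF p K True], of s] show ?thesis
        unfolding xy by (simp add: algebra_simps)
    next
      case False
      then have d: "- d \<ge> 0" by simp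
      from supporting_line[OF concave_on_burkholder[OF p K d], of "-s"]
      obtain m where m: "\<And>t. burkholder p K (- s + t + - d) (- s + t - - d) \<le>
        burkholder p K (- s + - d) (- s - - d) + m * t" by blast
      have sym: "burkholder p K (- a) (- b) = burkholder p K a b" for a b
        by (simp add: burkholder_def)
      show ?thesis
      proof (intro exI allI)
        fix t
        show "burkholder p K (x + t) (y + t) \<le> burkholder p K x y + (- m) * t"
          using m[of "- t"] sym[of "s + t + d" "s + t - d"] sym[of "s + d" "s - d"]
          unfolding xy by (simp add: algebra_simps)
      qed
    qed
  qed
  from e consider "e = 1" | "e = -1" by linarith
  then show ?thesis
  proof cases
    case 1 then show ?thesis using *[of x y] by simp
  next
    case 2
    have sym: "burkholder p K a (- b) = burkholder p K a b" for a b
        by (simp add: burkholder_def)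
    obtain m where m: "\<And>t. burkholder p K (x + t) (- y + t) \<le> burkholder p K x (- y) + m * t"
      using *[of x "- y"] by blast
    show ?thesis
    proof (intro exI allI)
      fix t show "burkholder p K (x + t) (y + e * t) \<le> burkholder p K x y + m * t"
        using m[of t] sym[of "x + t" "y - t"] sym[of x y] 2 by (simp add: algebra_simps)
    qed
  qed
qed

text \<open>
  Where \<open>\<bar>y\<bar>\<close> is at least \<open>2 * K * \<bar>x\<bar>\<close> the first factor of Burkholder's function is at least
  \<open>\<bar>y\<bar> / 2\<close>; elsewhere everything is of the order of \<open>\<bar>x\<bar> powr p\<close>.
\<close>

lemma burkholder_majorizes:
  fixes p K x y :: real
  assumes p: "1 < p" and K: "1 \<le> K"
  shows "\<bar>y\<bar> powr p \<le> ((2 * K) powr p + 2 * K * (1 + 2 * K) powr (p - 1)) * \<bar>x\<bar> powr p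
            + 2 * burkholder p K x y"
proof -
  have pw: "s powr p = s * s powr (p - 1)" if "s \<ge> 0" for s :: real
    using that p powr_mult_base[of s "p - 1"] by simp
  show ?thesis
  proof (cases "2 * K * \<bar>x\<bar> \<le> \<bar>y\<bar>")
    case True
    have "\<bar>y\<bar> powr p = \<bar>y\<bar> * \<bar>y\<bar> powr (p - 1)" by (rule pw) simp
    also have "\<dots> \<le> 2 * (\<bar>y\<bar> - K * \<bar>x\<bar>) * (\<bar>x\<bar> + \<bar>y\<bar>) powr (p - 1)"
      using True p by (intro mult_mono powr_mono2) auto
    finally have "\<bar>y\<bar> powr p \<le> 2 * burkholder p K x y" by (simp only: burkholder_def mult.assoc)
    then show ?thesis
      using K by (intro add_increasing) (auto intro!: mult_nonneg_nonneg add_nonneg_nonneg)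
  next
    case False
    have 1: "\<bar>y\<bar> powr p \<le> (2 * K) powr p * \<bar>x\<bar> powr p"
      using False p K by (subst powr_mult[symmetric]) (auto intro!: powr_mono2)
    have "K * \<bar>x\<bar> * (\<bar>x\<bar> + \<bar>y\<bar>) powr (p - 1) \<le> K * \<bar>x\<bar> * ((1 + 2 * K) * \<bar>x\<bar>) powr (p - 1)"
      using False p K by (intro mult_left_mono powr_mono2) (auto simp: algebra_simps)
    also have "\<dots> = K * (1 + 2 * K) powr (p - 1) * \<bar>x\<bar> powr p"
      using K by (simp add: powr_mult pw)
    finally have 2: "K * \<bar>x\<bar> * (\<bar>x\<bar> + \<bar>y\<bar>) powr (p - 1) \<le> \<dots>" .
    have "burkholder p K x y \<ge> - (K * \<bar>x\<bar> * (\<bar>x\<bar> + \<bar>y\<bar>) powr (p - 1))"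
      unfolding burkholder_def by (simp add: algebra_simps)
    with 1 2 show ?thesis by (simp add: algebra_simps)
  qed
qed

lemma burkholder_diagonal_nonpos:
  assumes "1 \<le> K" "\<bar>e\<bar> = 1"
  shows "burkholder p K c (e * c) \<le> 0"
proof -
  have "\<bar>e * c\<bar> - K * \<bar>c\<bar> = (1 - K) * \<bar>c\<bar>" using assms by (simp add: abs_mult algebra_simps)
  also have "\<dots> \<le> 0" using assms by (intro mult_nonpos_nonneg) auto
  finally show ?thesis unfolding burkholder_def by (rule mult_nonpos_nonneg) auto
qed

lemma burkholder_constant_exists:
  fixes p :: real
  assumes "1 < p"
  obtains K where "1 \<le> K" "\<bar>p - 2\<bar> * (K + 1) \<le> p * (K - 1)"
proof
  have gt: "p - \<bar>p - 2\<bar> > 0" using assms by auto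
  define K where "K = (p + \<bar>p - 2\<bar>) / (p - \<bar>p - 2\<bar>)"
  show "1 \<le> K" using gt by (simp add: K_def)
  show "\<bar>p - 2\<bar> * (K + 1) \<le> p * (K - 1)" using gt by (simp add: K_def field_simps)
qed

section \<open>Basic inequalities in the space of p-integrable functions\<close>

locale Lp_finite_measure = finite_measure M for M :: "'a measure" +
  fixes p :: real
  assumes p_gt_1: "1 < p"
begin

lemma Lp_measurable [measurable_dest]: "f \<in> Lp_space p M \<Longrightarrow> f \<in> borel_measurable M"
  by (simp add: Lp_space_def)

lemma Lp_integrable_powr: "f \<in> Lp_space p M \<Longrightarrow> integrable M (\<lambda>x. norm (f x) powr p)"
  by (simp add: Lp_space_def)

lemma Lp_norm_nonneg: "0 \<le> Lp_norm p M f"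
  by (simp add: Lp_norm_def)

lemma Lp_norm_powr: "Lp_norm p M f powr p = (LINT x|M. norm (f x) powr p)"
  using p_gt_1 by (simp add: Lp_norm_def powr_powr)

lemma Lp_norm_leI:
  assumes "(LINT x|M. norm (f x) powr p) \<le> c powr p" "0 \<le> c"
  shows "Lp_norm p M f \<le> c"
  using assms p_gt_1 Lp_norm_nonneg[of f] powr_mono2[of "1 / p" "Lp_norm p M f powr p" "c powr p"]
  by (simp add: Lp_norm_powr[symmetric] powr_powr)

lemma Lp_space_dominated:
  assumes "f \<in> borel_measurable M" "integrable M g" "\<And>x. x \<in> space M \<Longrightarrow> norm (f x) powr p \<le> g x"
  shows "f \<in> Lp_space p M"
proof -
  have "norm (norm (f x) powr p) \<le> norm (g x)" if "x \<in> space M" for x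
    using assms(3)[OF that] by simp
  then show ?thesis
    using assms(1) unfolding Lp_space_def
    by (auto intro!: Bochner_Integration.integrable_bound[OF assms(2)] AE_I2)
qed

lemma Lp_bounded:
  assumes "f \<in> borel_measurable M" "\<And>x. x \<in> space M \<Longrightarrow> norm (f x) \<le> B"
  shows "f \<in> Lp_space p M"
  using assms p_gt_1 by (intro Lp_space_dominated[where g = "\<lambda>_. B powr p"]) (auto intro!: powr_mono2)

lemma norm_add_powr_le:
  fixes a b :: complex
  shows "norm (a + b) powr p \<le> 2 powr p * (norm a powr p + norm b powr p)"
proof -
  have "norm (a + b) \<le> 2 * max (norm a) (norm b)"
    using norm_triangle_ineq[of a b] by linarith
  then have "norm (a + b) powr p \<le> (2 * max (norm a) (norm b)) powr p"
    using p_gt_1 by (intro powr_mono2) auto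
  also have "\<dots> = 2 powr p * max (norm a) (norm b) powr p" by (simp add: powr_mult)
  also have "\<dots> \<le> 2 powr p * (norm a powr p + norm b powr p)"
    by (intro mult_left_mono) (auto simp: max_def)
  finally show ?thesis .
qed

lemma Lp_add:
  assumes "f \<in> Lp_space p M" "g \<in> Lp_space p M"
  shows "(\<lambda>x. f x + g x) \<in> Lp_space p M"
  using assms Lp_integrable_powr[OF assms(1)] Lp_integrable_powr[OF assms(2)]
  by (intro Lp_space_dominated[where g = "\<lambda>x. 2 powr p * (norm (f x) powr p + norm (g x) powr p)"]
        norm_add_powr_le) (auto dest: Lp_measurable)

lemma Lp_cmult:
  assumes "f \<in> Lp_space p M"
  shows "(\<lambda>x. c * f x) \<in> Lp_space p M"
  using assms by (auto simp: Lp_space_def norm_mult powr_mult)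

lemma Lp_zero: "(\<lambda>x. 0) \<in> Lp_space p M"
  by (rule Lp_bounded[where B = 0]) auto

lemma Lp_sum:
  assumes "\<And>i. i \<in> I \<Longrightarrow> f i \<in> Lp_space p M"
  shows "(\<lambda>x. \<Sum>i\<in>I. f i x) \<in> Lp_space p M"
  using assms by (induction I rule: infinite_finite_induct) (auto intro: Lp_add Lp_zero)

lemma Lp_diff:
  assumes "f \<in> Lp_space p M" "g \<in> Lp_space p M"
  shows "(\<lambda>x. f x - g x) \<in> Lp_space p M"
  using Lp_add[OF assms(1) Lp_cmult[OF assms(2), of "-1"]] by simp

lemma Lp_norm_cmult: "Lp_norm p M (\<lambda>x. c * f x) = norm c * Lp_norm p M f"
  using p_gt_1 by (simp add: Lp_norm_def norm_mult powr_mult powr_powr)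

lemma Lp_norm_minus_commute: "Lp_norm p M (\<lambda>x. f x - g x) = Lp_norm p M (\<lambda>x. g x - f x)"
  by (simp add: Lp_norm_def norm_minus_commute)

lemma Lp_norm_AE_zero:
  assumes "AE x in M. f x = 0"
  shows "Lp_norm p M f = 0"
proof -
  have "(LINT x|M. norm (f x) powr p) = 0"
    using assms p_gt_1 by (intro integral_eq_zero_AE) auto
  then show ?thesis by (simp add: Lp_norm_def)
qed

lemma Lp_scaled_integrable:
  assumes "f \<in> Lp_space p M" "0 < c"
  shows "integrable M (\<lambda>x. (norm (f x) / c) powr p)"
  using assms Lp_integrable_powr[OF assms(1)] by (simp add: powr_divide)

lemma Lp_scaled_integral_le_1:
  assumes "f \<in> Lp_space p M" "0 < c" "Lp_norm p M f \<le> c"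
  shows "(LINT x|M. (norm (f x) / c) powr p) \<le> 1"
proof -
  have "Lp_norm p M f powr p \<le> c powr p"
    using assms p_gt_1 Lp_norm_nonneg[of f] by (intro powr_mono2) auto
  then show ?thesis
    using assms by (simp add: powr_divide Lp_norm_powr[symmetric] divide_le_eq)
qed

text \<open>
  Minkowski's inequality. The sum is a multiple of a convex combination of two functions of norm at
  most \<open>1\<close>, and \<open>t \<mapsto> t powr p\<close> is convex. Enlarging both norms by \<open>e / 2\<close> avoids dividing by zero.
\<close>

lemma Lp_norm_triangle:
  assumes f: "f \<in> Lp_space p M" and g: "g \<in> Lp_space p M"
  shows "Lp_norm p M (\<lambda>x. f x + g x) \<le> Lp_norm p M f + Lp_norm p M g"
proof (rule field_le_epsilon)
  fix e :: real assume e: "0 < e"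
  define a where "a = Lp_norm p M f + e / 2"
  define b where "b = Lp_norm p M g + e / 2"
  have ab: "a > 0" "b > 0" using e Lp_norm_nonneg[of f] Lp_norm_nonneg[of g] by (auto simp: a_def b_def)
  define l where "l = b / (a + b)"
  have l: "0 \<le> l" "l \<le> 1" "(a + b) * (1 - l) = a" "(a + b) * l = b"
    using ab by (auto simp: l_def field_simps)
  have "(LINT x|M. norm (f x + g x) powr p) \<le>
        (LINT x|M. (a + b) powr p * ((1 - l) * (norm (f x) / a) powr p + l * (norm (g x) / b) powr p))"
  proof (rule integral_mono)
    show "integrable M (\<lambda>x. norm (f x + g x) powr p)" using Lp_integrable_powr[OF Lp_add[OF f g]] .
    show "integrable M (\<lambda>x. (a + b) powr p * ((1 - l) * (norm (f x) / a) powr p + l * (norm (g x) / b) powr p))"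
      using Lp_scaled_integrable[OF f, of a] Lp_scaled_integrable[OF g, of b] ab e by (auto simp: a_def b_def)
    fix x
    have "norm (f x + g x) \<le> (a + b) * ((1 - l) *\<^sub>R (norm (f x) / a) + l *\<^sub>R (norm (g x) / b))"
      using ab norm_triangle_ineq[of "f x" "g x"]
      by (simp add: distrib_left mult.assoc[symmetric] l(3,4))
    then have "norm (f x + g x) powr p \<le> ((a + b) * ((1 - l) *\<^sub>R (norm (f x) / a) + l *\<^sub>R (norm (g x) / b))) powr p"
      using p_gt_1 by (intro powr_mono2) auto
    also have "\<dots> = (a + b) powr p * ((1 - l) *\<^sub>R (norm (f x) / a) + l *\<^sub>R (norm (g x) / b)) powr p"
      using ab l by (intro powr_mult)
    also have "\<dots> \<le> (a + b) powr p * ((1 - l) * (norm (f x) / a) powr p + l * (norm (g x) / b) powr p)"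
      using l ab p_gt_1 by (intro mult_left_mono convex_onD[OF convex_on_powr_nonneg]) auto
    finally show "norm (f x + g x) powr p \<le> \<dots>" .
  qed
  also have "\<dots> = (a + b) powr p * ((1 - l) * (LINT x|M. (norm (f x) / a) powr p) + l * (LINT x|M. (norm (g x) / b) powr p))"
    using Lp_scaled_integrable[OF f, of a] Lp_scaled_integrable[OF g, of b] ab e by (simp add: a_def b_def)
  also have "\<dots> \<le> (a + b) powr p * ((1 - l) * 1 + l * 1)"
    using Lp_scaled_integral_le_1[OF f, of a] Lp_scaled_integral_le_1[OF g, of b] ab e l
    by (intro mult_left_mono add_mono) (auto simp: a_def b_def)
  finally have "(LINT x|M. norm (f x + g x) powr p) \<le> (a + b) powr p" by simp
  then have "Lp_norm p M (\<lambda>x. f x + g x) \<le> a + b" using ab by (intro Lp_norm_leI) auto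
  then show "Lp_norm p M (\<lambda>x. f x + g x) \<le> Lp_norm p M f + Lp_norm p M g + e"
    by (simp add: a_def b_def)
qed

lemma Lp_norm_sum:
  assumes "\<And>i. i \<in> I \<Longrightarrow> f i \<in> Lp_space p M"
  shows "Lp_norm p M (\<lambda>x. \<Sum>i\<in>I. f i x) \<le> (\<Sum>i\<in>I. Lp_norm p M (f i))"
  using assms
proof (induction I rule: infinite_finite_induct)
  case (insert i I)
  then have "Lp_norm p M (\<lambda>x. f i x + (\<Sum>i\<in>I. f i x)) \<le> Lp_norm p M (f i) + Lp_norm p M (\<lambda>x. \<Sum>i\<in>I. f i x)"
    by (intro Lp_norm_triangle Lp_sum) auto
  with insert show ?case by fastforce
qed (auto intro: Lp_norm_AE_zero simp: Lp_norm_AE_zero)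

lemma Lp_norm_diff_triangle:
  assumes "f \<in> Lp_space p M" "g \<in> Lp_space p M" "h \<in> Lp_space p M"
  shows "Lp_norm p M (\<lambda>x. f x - h x) \<le> Lp_norm p M (\<lambda>x. f x - g x) + Lp_norm p M (\<lambda>x. g x - h x)"
  using Lp_norm_triangle[OF Lp_diff[OF assms(1,2)] Lp_diff[OF assms(2,3)]] by simp

lemma Lp_norm_cong_AE:
  assumes "AE x in M. f x = g x" "f \<in> borel_measurable M" "g \<in> borel_measurable M"
  shows "Lp_norm p M f = Lp_norm p M g"
proof -
  have "(LINT x|M. norm (f x) powr p) = (LINT x|M. norm (g x) powr p)"
    using assms by (intro integral_cong_AE) auto
  then show ?thesis by (simp add: Lp_norm_def)
qed

lemma le_one_plus_powr:
  fixes t :: real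
  assumes "0 \<le> t"
  shows "t \<le> 1 + t powr p"
  using assms p_gt_1 powr_mono[of 1 p t] by (cases "t \<le> 1") (auto intro: add_increasing2)

lemma Lp_integrable:
  assumes f: "f \<in> Lp_space p M"
  shows "integrable M f"
proof (rule Bochner_Integration.integrable_bound)
  show "integrable M (\<lambda>x. 1 + norm (f x) powr p)" using Lp_integrable_powr[OF f] by simp
  show "f \<in> borel_measurable M" using f by (rule Lp_measurable)
  show "AE x in M. norm (f x) \<le> norm (1 + norm (f x) powr p)"
    using le_one_plus_powr[of "norm (f _)"] by auto
qed

text \<open>
  On a finite measure space \<open>L\<^sup>p\<close> embeds into \<open>L\<^sup>1\<close>: integrate \<open>t \<le> 1 + t powr p\<close> for
  \<open>t = norm (f x) / c\<close>, with \<open>c\<close> decreasing to the norm of \<open>f\<close>.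
\<close>

lemma Lp_integral_norm_le:
  assumes f: "f \<in> Lp_space p M"
  shows "(LINT x|M. norm (f x)) \<le> (measure M (space M) + 1) * Lp_norm p M f"
proof (rule field_le_epsilon)
  fix e :: real assume e: "0 < e"
  define m where "m = measure M (space M) + 1"
  have m: "m > 0" by (simp add: m_def add_nonneg_pos)
  define c where "c = Lp_norm p M f + e / m"
  have c: "c > 0" using e m Lp_norm_nonneg[of f] by (auto simp: c_def intro: add_nonneg_pos)
  have "(LINT x|M. norm (f x) / c) \<le> (LINT x|M. 1 + (norm (f x) / c) powr p)"
  proof (rule integral_mono)
    show "integrable M (\<lambda>x. norm (f x) / c)" using Lp_integrable[OF f] by simp
    show "integrable M (\<lambda>x. 1 + (norm (f x) / c) powr p)"
      using Lp_scaled_integrable[OF f c] by simp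
    show "norm (f x) / c \<le> 1 + (norm (f x) / c) powr p" for x
      using le_one_plus_powr[of "norm (f x) / c"] c by simp
  qed
  also have "\<dots> \<le> m"
    using Lp_scaled_integrable[OF f c] Lp_scaled_integral_le_1[OF f c] e m
    by (simp add: m_def c_def)
  finally have "(LINT x|M. norm (f x)) \<le> m * c" using c by (simp add: divide_le_eq)
  also have "\<dots> = m * Lp_norm p M f + e" using m by (simp add: c_def distrib_left)
  finally show "(LINT x|M. norm (f x)) \<le> (measure M (space M) + 1) * Lp_norm p M f + e"
    by (simp add: m_def)
qed

end

section \<open>Unconditionality of martingale difference systems\<close>

context Lp_finite_measure begin

text \<open>
  Multipliers in \<open>[0, 1]\<close> are convex combinations of \<open>0\<close>-\<open>1\<close> multipliers, and the norm is convex.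
  The coefficients are treated one at a time: \<open>H\<close> is the set of indices that already carry a general
  multiplier, \<open>G\<close> the set of those with multiplier \<open>1\<close>.
\<close>

lemma Lp_norm_multiplier_le:
  assumes "finite F" and v: "\<And>k. k \<in> F \<Longrightarrow> v k \<in> Lp_space p M"
    and B: "\<And>G. G \<subseteq> F \<Longrightarrow> Lp_norm p M (\<lambda>x. \<Sum>k\<in>G. v k x) \<le> B"
    and l: "\<And>k. k \<in> F \<Longrightarrow> 0 \<le> l k \<and> l k \<le> (1::real)"
  shows "Lp_norm p M (\<lambda>x. \<Sum>k\<in>F. of_real (l k) * v k x) \<le> B"
proof -
  have "Lp_norm p M (\<lambda>x. (\<Sum>k\<in>H. of_real (l k) * v k x) + (\<Sum>k\<in>G. v k x)) \<le> B"
    if "finite H" "H \<subseteq> F" "G \<subseteq> F - H" for H G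
    using that
  proof (induction H arbitrary: G rule: finite_induct)
    case empty
    then show ?case using B[of G] by simp
  next
    case (insert a H)
    define T where "T G x = (\<Sum>k\<in>H. of_real (l k) * v k x) + (\<Sum>k\<in>G. v k x)" for G x
    have G: "finite G" "a \<notin> G"
      using insert.prems \<open>finite F\<close> finite_subset[of G F] by blast+
    have HF: "H \<subseteq> F" using insert.prems by simp
    have T: "T G' \<in> Lp_space p M" if "G' \<subseteq> F" for G'
      unfolding T_def by (intro Lp_add Lp_sum Lp_cmult v) (use that HF in auto)
    have le: "Lp_norm p M (T G') \<le> B" if "G' \<subseteq> F - H" for G'
      unfolding T_def by (rule insert.IH[OF HF that])
    have sub: "insert a G \<subseteq> F - H" "G \<subseteq> F - H" "insert a G \<subseteq> F" "G \<subseteq> F"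
      using insert.hyps insert.prems by blast+
    have la: "0 \<le> l a" "l a \<le> 1" using l[of a] insert.prems by simp_all
    have "(\<lambda>x. (\<Sum>k\<in>insert a H. of_real (l k) * v k x) + (\<Sum>k\<in>G. v k x))
        = (\<lambda>x. of_real (l a) * T (insert a G) x + of_real (1 - l a) * T G x)"
      using insert.hyps G by (auto simp: T_def algebra_simps)
    then have "Lp_norm p M (\<lambda>x. (\<Sum>k\<in>insert a H. of_real (l k) * v k x) + (\<Sum>k\<in>G. v k x))
       \<le> Lp_norm p M (\<lambda>x. of_real (l a) * T (insert a G) x) + Lp_norm p M (\<lambda>x. of_real (1 - l a) * T G x)"
      using Lp_norm_triangle[OF Lp_cmult[OF T] Lp_cmult[OF T]] sub by simp
    also have "\<dots> \<le> l a * B + (1 - l a) * B"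
      unfolding Lp_norm_cmult norm_of_real using le[OF sub(1)] le[OF sub(2)] la
      by (intro add_mono mult_mono) (auto simp: Lp_norm_nonneg)
    finally show ?case by (simp add: algebra_simps)
  qed
  from this[of F "{}"] \<open>finite F\<close> show ?thesis by simp
qed

end

text \<open>
  The last assumption makes \<open>\<Sum>\<^sub>k a\<^sub>k h\<^sub>k\<close> a martingale for every choice of coefficients: given the
  earlier functions, \<open>h k\<close> is a mean-zero perturbation on a set on which they are all constant.
\<close>

locale martingale_difference_system = Lp_finite_measure M p for M :: "'a measure" and p :: real +
  fixes h :: "nat \<Rightarrow> 'a \<Rightarrow> real"
  assumes h_measurable [measurable]: "\<And>k. h k \<in> borel_measurable M"
    and h_bounded: "\<And>k x. x \<in> space M \<Longrightarrow> \<bar>h k x\<bar> \<le> 1"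
    and h_0: "\<And>x. x \<in> space M \<Longrightarrow> h 0 x = 1"
    and h_mean_zero: "\<And>k. 0 < k \<Longrightarrow> (LINT x|M. h k x) = 0"
    and h_const_on_support: "\<And>j k x y. j < k \<Longrightarrow> x \<in> space M \<Longrightarrow> y \<in> space M \<Longrightarrow>
          h k x \<noteq> 0 \<Longrightarrow> h k y \<noteq> 0 \<Longrightarrow> h j x = h j y"
begin

lemma integrable_h: "integrable M (h k)"
  by (rule integrable_const_bound[where B = 1]) (simp_all add: h_bounded)

lemma sum_h_bounded:
  fixes a :: "nat \<Rightarrow> real"
  assumes "x \<in> space M"
  shows "\<bar>\<Sum>k\<in>F. a k * h k x\<bar> \<le> (\<Sum>k\<in>F. \<bar>a k\<bar>)"
proof -
  have "\<bar>\<Sum>k\<in>F. a k * h k x\<bar> \<le> (\<Sum>k\<in>F. \<bar>a k * h k x\<bar>)" by (rule sum_abs)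
  also have "\<dots> \<le> (\<Sum>k\<in>F. \<bar>a k\<bar>)"
    using h_bounded[OF assms] by (intro sum_mono) (simp add: abs_mult mult_left_le)
  finally show ?thesis .
qed

lemma integrable_burkholder:
  fixes X Y :: "'a \<Rightarrow> real"
  assumes [measurable]: "X \<in> borel_measurable M" "Y \<in> borel_measurable M"
    and b: "\<And>x. x \<in> space M \<Longrightarrow> \<bar>X x\<bar> \<le> b" "\<And>x. x \<in> space M \<Longrightarrow> \<bar>Y x\<bar> \<le> c" and K: "1 \<le> K"
  shows "integrable M (\<lambda>x. burkholder p K (X x) (Y x))"
proof (rule integrable_const_bound[of _ "(c + K * b) * (b + c) powr (p - 1)"])
  show "(\<lambda>x. burkholder p K (X x) (Y x)) \<in> borel_measurable M" unfolding burkholder_def by measurable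
  have "norm (burkholder p K (X x) (Y x)) \<le> (c + K * b) * (b + c) powr (p - 1)" if x: "x \<in> space M" for x
  proof -
    have "\<bar>\<bar>Y x\<bar> - K * \<bar>X x\<bar>\<bar> \<le> \<bar>Y x\<bar> + K * \<bar>X x\<bar>" using K by (simp add: abs_diff_le_iff abs_le_iff)
    also have "\<dots> \<le> c + K * b" using b[OF x] K by (intro add_mono mult_left_mono) auto
    finally have "\<bar>\<bar>Y x\<bar> - K * \<bar>X x\<bar>\<bar> \<le> c + K * b" .
    then show ?thesis unfolding burkholder_def real_norm_def abs_mult
      using b[OF x] p_gt_1 by (auto intro!: mult_mono powr_mono2)
  qed
  then show "AE x in M. norm (burkholder p K (X x) (Y x)) \<le> (c + K * b) * (b + c) powr (p - 1)" by auto
qed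

text \<open>
  Where \<open>h n\<close> does not vanish, the partial sums \<open>X n\<close>, \<open>Y n\<close> are constant, so one supporting line of
  Burkholder's function works there simultaneously; elsewhere nothing changes. The linear term of the
  supporting line integrates to zero.
\<close>

lemma integral_burkholder_nonpos:
  fixes a \<epsilon> :: "nat \<Rightarrow> real"
  assumes K: "1 \<le> K" "\<bar>p - 2\<bar> * (K + 1) \<le> p * (K - 1)" and \<epsilon>: "\<And>k. \<bar>\<epsilon> k\<bar> = 1"
  shows "(LINT x|M. burkholder p K (\<Sum>k<n. a k * h k x) (\<Sum>k<n. \<epsilon> k * a k * h k x)) \<le> 0"
proof -
  define X where "X n x = (\<Sum>k<n. a k * h k x)" for n x
  define Y where "Y n x = (\<Sum>k<n. \<epsilon> k * a k * h k x)" for n x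
  have int: "integrable M (\<lambda>x. burkholder p K (X n x) (Y n x))" for n
    unfolding X_def Y_def
    by (rule integrable_burkholder[OF _ _ sum_h_bounded sum_h_bounded K(1)]) auto
  have "(LINT x|M. burkholder p K (X n x) (Y n x)) \<le> 0"
  proof (induction n)
    case 0
    then show ?case by (simp add: X_def Y_def burkholder_def)
  next
    case (Suc n)
    show ?case
    proof (cases "n = 0")
      case True
      have "burkholder p K (X 1 x) (Y 1 x) \<le> 0" if "x \<in> space M" for x
        using burkholder_diagonal_nonpos[OF K(1) \<epsilon>, of p "a 0" 0] h_0[OF that] by (simp add: X_def Y_def)
      then have "(LINT x|M. - burkholder p K (X 1 x) (Y 1 x)) \<ge> 0"
        by (intro Bochner_Integration.integral_nonneg) auto
      then show ?thesis using True by simp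
    next
      case False
      obtain m where m: "\<And>x. x \<in> space M \<Longrightarrow> burkholder p K (X (Suc n) x) (Y (Suc n) x)
             \<le> burkholder p K (X n x) (Y n x) + m * h n x"
      proof (cases "\<exists>z\<in>space M. h n z \<noteq> 0")
        case True
        then obtain z where z: "z \<in> space M" "h n z \<noteq> 0" by blast
        obtain m where m: "\<And>t. burkholder p K (X n z + t) (Y n z + \<epsilon> n * t) \<le> burkholder p K (X n z) (Y n z) + m * t"
          using burkholder_supporting_line[OF p_gt_1 K \<epsilon>] by blast
        show ?thesis
        proof (rule that[of "m * a n"])
          fix x assume x: "x \<in> space M"
          show "burkholder p K (X (Suc n) x) (Y (Suc n) x) \<le> burkholder p K (X n x) (Y n x) + m * a n * h n x"
          proof (cases "h n x = 0")
            case True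
            then show ?thesis by (simp add: X_def Y_def)
          next
            case False
            have "h j x = h j z" if "j < n" for j
              using h_const_on_support[OF that x z(1) False z(2)] .
            then have "X n x = X n z" "Y n x = Y n z" by (auto simp: X_def Y_def)
            then show ?thesis using m[of "a n * h n x"] by (simp add: X_def Y_def mult.assoc)
          qed
        qed
      next
        case False
        then show ?thesis by (intro that[of 0]) (auto simp: X_def Y_def)
      qed
      have "(LINT x|M. burkholder p K (X (Suc n) x) (Y (Suc n) x)) \<le>
            (LINT x|M. burkholder p K (X n x) (Y n x) + m * h n x)"
        using int integrable_h m by (intro integral_mono) auto
      also have "\<dots> = (LINT x|M. burkholder p K (X n x) (Y n x))"
        using int integrable_h h_mean_zero[of n] False by simp
      finally show ?thesis using Suc by simp
    qed
  qed
  then show ?thesis by (simp add: X_def Y_def)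
qed

text \<open>
  Integrating the majorization of \<open>\<bar>y\<bar> powr p\<close> by Burkholder's function, whose integral is nonpositive.
\<close>

lemma sign_change_real:
  "\<exists>C\<ge>0. \<forall>(a :: nat \<Rightarrow> real) \<epsilon> n. (\<forall>k. \<bar>\<epsilon> k\<bar> = 1) \<longrightarrow>
     (LINT x|M. \<bar>\<Sum>k<n. \<epsilon> k * a k * h k x\<bar> powr p) \<le> C * (LINT x|M. \<bar>\<Sum>k<n. a k * h k x\<bar> powr p)"
proof -
  obtain K where K: "1 \<le> K" "\<bar>p - 2\<bar> * (K + 1) \<le> p * (K - 1)"
    using burkholder_constant_exists[OF p_gt_1] by blast
  define C where "C = (2 * K) powr p + 2 * K * (1 + 2 * K) powr (p - 1)"
  have "C \<ge> 0" using K by (simp add: C_def)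
  moreover have "(LINT x|M. \<bar>\<Sum>k<n. \<epsilon> k * a k * h k x\<bar> powr p) \<le> C * (LINT x|M. \<bar>\<Sum>k<n. a k * h k x\<bar> powr p)"
    if \<epsilon>: "\<And>k. \<bar>\<epsilon> k\<bar> = 1" for a \<epsilon> :: "nat \<Rightarrow> real" and n
  proof -
    define X where "X x = (\<Sum>k<n. a k * h k x)" for x
    define Y where "Y x = (\<Sum>k<n. \<epsilon> k * a k * h k x)" for x
    have [measurable]: "X \<in> borel_measurable M" "Y \<in> borel_measurable M"
      unfolding X_def Y_def by measurable
    have U: "integrable M (\<lambda>x. burkholder p K (X x) (Y x))"
      unfolding X_def Y_def
      by (rule integrable_burkholder[OF _ _ sum_h_bounded sum_h_bounded K(1)]) auto
    have powr_int: "integrable M (\<lambda>x. \<bar>\<Sum>k<n. b k * h k x\<bar> powr p)" for b :: "nat \<Rightarrow> real"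
      using sum_h_bounded[of _ b "{..<n}"] p_gt_1
      by (intro integrable_const_bound[of _ "(\<Sum>k<n. \<bar>b k\<bar>) powr p"]) (auto intro!: AE_I2 powr_mono2)
    have "(LINT x|M. \<bar>Y x\<bar> powr p) \<le> (LINT x|M. C * \<bar>X x\<bar> powr p + 2 * burkholder p K (X x) (Y x))"
      using U powr_int[of a] powr_int[of "\<lambda>k. \<epsilon> k * a k"] burkholder_majorizes[OF p_gt_1 K(1)]
      by (intro integral_mono) (auto simp: X_def Y_def C_def)
    also have "\<dots> = C * (LINT x|M. \<bar>X x\<bar> powr p) + 2 * (LINT x|M. burkholder p K (X x) (Y x))"
      using U powr_int[of a] by (simp add: X_def)
    also have "(LINT x|M. burkholder p K (X x) (Y x)) \<le> 0"
      unfolding X_def Y_def by (rule integral_burkholder_nonpos[OF K \<epsilon>])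
    finally show ?thesis by (simp add: X_def Y_def)
  qed
  ultimately show ?thesis by blast
qed

lemma Lp_h: "(\<lambda>x. of_real (h k x)) \<in> Lp_space p M"
  using h_bounded by (intro Lp_bounded[where B = 1]) auto

lemma Lp_sum_h: "(\<lambda>x. \<Sum>k\<in>F. a k * of_real (h k x)) \<in> Lp_space p M"
  by (intro Lp_sum Lp_cmult Lp_h)

text \<open>
  Selecting the indices in \<open>F\<close> is the average of the identity and of the sign change that is \<open>1\<close> on
  \<open>F\<close> and \<open>-1\<close> elsewhere. Complex coefficients are handled by splitting into real and imaginary parts,
  since the \<open>h k\<close> are real.
\<close>

lemma subset_sum_bound:
  obtains C where "0 \<le> C"
    "\<And>(a :: nat \<Rightarrow> complex) (n :: nat) F. F \<subseteq> {..<n} \<Longrightarrow> Lp_norm p M (\<lambda>x. \<Sum>k\<in>F. a k * of_real (h k x))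
        \<le> C * Lp_norm p M (\<lambda>x. \<Sum>k<n. a k * of_real (h k x))"
proof -
  obtain C where C0: "C \<ge> 0" and C: "\<And>(a :: nat \<Rightarrow> real) \<epsilon> n. (\<And>k. \<bar>\<epsilon> k\<bar> = 1) \<Longrightarrow>
     (LINT x|M. \<bar>\<Sum>k<n. \<epsilon> k * a k * h k x\<bar> powr p) \<le> C * (LINT x|M. \<bar>\<Sum>k<n. a k * h k x\<bar> powr p)"
    using sign_change_real by blast
  define D where "D = 1 + 2 powr p * (C + C)"
  have D: "D \<ge> 0" using C0 by (auto simp: D_def intro!: add_nonneg_nonneg mult_nonneg_nonneg)
  show ?thesis
  proof (rule that[of "D powr (1 / p)"])
    fix a :: "nat \<Rightarrow> complex" and n :: nat and F assume F: "F \<subseteq> {..<n}"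
    define \<epsilon> where "\<epsilon> k = (if k \<in> F then 1 else - 1 :: real)" for k
    define X where "X x = (\<Sum>k<n. a k * of_real (h k x))" for x
    define Y where "Y x = (\<Sum>k<n. of_real (\<epsilon> k) * a k * of_real (h k x))" for x
    have X: "X \<in> Lp_space p M" and Y: "Y \<in> Lp_space p M"
      unfolding X_def Y_def by (auto intro: Lp_sum_h)
    have [measurable]: "X \<in> borel_measurable M" "Y \<in> borel_measurable M"
      using X Y by (auto intro: Lp_measurable)
    have part: "integrable M (\<lambda>x. \<bar>Re (f x)\<bar> powr p)" "integrable M (\<lambda>x. \<bar>Im (f x)\<bar> powr p)"
       if f: "f \<in> Lp_space p M" for f
      using Lp_integrable_powr[OF f] Lp_measurable[OF f] p_gt_1 abs_Re_le_cmod abs_Im_le_cmod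
      by (auto intro!: Bochner_Integration.integrable_bound[OF Lp_integrable_powr[OF f]] AE_I2 powr_mono2)
    have ReX: "Re (X x) = (\<Sum>k<n. Re (a k) * h k x)" "Im (X x) = (\<Sum>k<n. Im (a k) * h k x)" for x
      by (simp_all add: X_def)
    have ReY: "Re (Y x) = (\<Sum>k<n. \<epsilon> k * Re (a k) * h k x)" "Im (Y x) = (\<Sum>k<n. \<epsilon> k * Im (a k) * h k x)" for x
      by (simp_all add: Y_def mult.assoc)
    have "(LINT x|M. norm (Y x) powr p) \<le> (LINT x|M. 2 powr p * (\<bar>Re (Y x)\<bar> powr p + \<bar>Im (Y x)\<bar> powr p))"
    proof (rule integral_mono)
      fix x
      have "norm (of_real (Re (Y x)) + \<i> * of_real (Im (Y x))) powr p \<le>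
         2 powr p * (norm (of_real (Re (Y x)) :: complex) powr p + norm (\<i> * of_real (Im (Y x))) powr p)"
        by (rule norm_add_powr_le)
      then show "norm (Y x) powr p \<le> 2 powr p * (\<bar>Re (Y x)\<bar> powr p + \<bar>Im (Y x)\<bar> powr p)"
        using complex_eq[of "Y x"] by (simp add: norm_mult)
    qed (use part[OF Y] Lp_integrable_powr[OF Y] in auto)
    also have "\<dots> = 2 powr p * ((LINT x|M. \<bar>Re (Y x)\<bar> powr p) + (LINT x|M. \<bar>Im (Y x)\<bar> powr p))"
      using part[OF Y] by simp
    also have "\<dots> \<le> 2 powr p * (C * (LINT x|M. \<bar>Re (X x)\<bar> powr p) + C * (LINT x|M. \<bar>Im (X x)\<bar> powr p))"
      unfolding ReX ReY by (intro mult_left_mono add_mono C) (auto simp: \<epsilon>_def)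
    also have "\<dots> \<le> 2 powr p * (C * (LINT x|M. norm (X x) powr p) + C * (LINT x|M. norm (X x) powr p))"
      using part[OF X] Lp_integrable_powr[OF X] C0 p_gt_1
      by (intro mult_left_mono add_mono integral_mono powr_mono2 abs_Re_le_cmod abs_Im_le_cmod) auto
    finally have YX: "(LINT x|M. norm (Y x) powr p) \<le> 2 powr p * (C + C) * (LINT x|M. norm (X x) powr p)"
      by (simp add: algebra_simps)
    have half: "(\<Sum>k\<in>F. a k * of_real (h k x)) = X x / 2 + Y x / 2" for x
    proof -
      have "X x + Y x = (\<Sum>k<n. (if k \<in> F then 2 * (a k * of_real (h k x)) else 0))"
        unfolding X_def Y_def sum.distrib[symmetric] by (intro sum.cong) (auto simp: \<epsilon>_def)
      also have "\<dots> = (\<Sum>k\<in>F. 2 * (a k * of_real (h k x)))"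
        using F by (simp add: sum.If_cases Int_absorb1)
      finally have "X x + Y x = 2 * (\<Sum>k\<in>F. a k * of_real (h k x))"
        by (simp only: sum_distrib_left[symmetric])
      then show ?thesis by (simp add: add_divide_distrib[symmetric])
    qed
    have "(LINT x|M. norm (\<Sum>k\<in>F. a k * of_real (h k x)) powr p) \<le> (LINT x|M. norm (X x) powr p + norm (Y x) powr p)"
    proof (rule integral_mono)
      show "integrable M (\<lambda>x. norm (\<Sum>k\<in>F. a k * of_real (h k x)) powr p)"
        by (rule Lp_integrable_powr[OF Lp_sum_h])
      fix x
      show "norm (\<Sum>k\<in>F. a k * of_real (h k x)) powr p \<le> norm (X x) powr p + norm (Y x) powr p"
        unfolding half using norm_add_powr_le[of "X x / 2" "Y x / 2"] p_gt_1
        by (simp add: norm_divide powr_divide field_simps)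
    qed (use Lp_integrable_powr[OF X] Lp_integrable_powr[OF Y] in auto)
    also have "\<dots> \<le> D * (LINT x|M. norm (X x) powr p)"
      using Lp_integrable_powr[OF X] Lp_integrable_powr[OF Y] YX by (simp add: D_def algebra_simps)
    also have "\<dots> = (D powr (1 / p) * Lp_norm p M X) powr p"
      using D p_gt_1 by (simp add: powr_mult powr_powr Lp_norm_powr)
    finally show "Lp_norm p M (\<lambda>x. \<Sum>k\<in>F. a k * of_real (h k x))
        \<le> D powr (1 / p) * Lp_norm p M (\<lambda>x. \<Sum>k<n. a k * of_real (h k x))"
      unfolding X_def by (intro Lp_norm_leI) (auto simp: Lp_norm_nonneg)
  qed simp
qed

text \<open>
  If \<open>h k\<close> vanishes almost everywhere, division by zero makes the functional zero, which is the right
  value since the term of index \<open>k\<close> is then irrelevant.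
\<close>

definition coef :: "nat \<Rightarrow> ('a \<Rightarrow> complex) \<Rightarrow> complex" where
  "coef k f = (LINT x|M. f x * of_real (h k x)) / of_real (LINT x|M. (h k x)\<^sup>2)"

lemma integrable_mult_h:
  assumes "f \<in> Lp_space p M"
  shows "integrable M (\<lambda>x. f x * of_real (h k x))"
proof (rule Bochner_Integration.integrable_bound[OF Lp_integrable[OF assms]])
  show "(\<lambda>x. f x * of_real (h k x)) \<in> borel_measurable M" using Lp_measurable[OF assms] by measurable
  show "AE x in M. norm (f x * of_real (h k x)) \<le> norm (f x)"
    using h_bounded by (intro AE_I2) (auto simp: norm_mult intro: mult_left_le)
qed

lemma coef_add:
  assumes "f \<in> Lp_space p M" "g \<in> Lp_space p M"
  shows "coef k (\<lambda>x. f x + g x) = coef k f + coef k g"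
  using integrable_mult_h[OF assms(1)] integrable_mult_h[OF assms(2)]
  by (simp add: coef_def distrib_right add_divide_distrib)

lemma coef_cmult: "coef k (\<lambda>x. c * f x) = c * coef k f"
  by (simp add: coef_def mult.assoc)

lemma coef_diff:
  assumes "f \<in> Lp_space p M" "g \<in> Lp_space p M"
  shows "coef k (\<lambda>x. f x - g x) = coef k f - coef k g"
proof -
  have "coef k (\<lambda>x. f x + (- 1) * g x) = coef k f + (- 1) * coef k g"
    by (simp only: coef_add[OF assms(1) Lp_cmult[OF assms(2)]] coef_cmult)
  then show ?thesis by simp
qed

lemma coef_sum:
  assumes "\<And>i. i \<in> I \<Longrightarrow> f i \<in> Lp_space p M"
  shows "coef k (\<lambda>x. \<Sum>i\<in>I. f i x) = (\<Sum>i\<in>I. coef k (f i))"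
  using assms
proof (induction I rule: infinite_finite_induct)
  case (insert i I)
  then show ?case using coef_add[of "f i" "\<lambda>x. \<Sum>i\<in>I. f i x" k] by (simp add: Lp_sum)
qed (simp_all add: coef_def)

lemma coef_bound:
  obtains D where "\<And>k. 0 \<le> D k" "\<And>k f. f \<in> Lp_space p M \<Longrightarrow> norm (coef k f) \<le> D k * Lp_norm p M f"
proof
  let ?D = "\<lambda>k. (measure M (space M) + 1) / (LINT x|M. (h k x)\<^sup>2)"
  show "0 \<le> ?D k" for k by (simp add: add_nonneg_nonneg)
  fix k f assume f: "f \<in> Lp_space p M"
  have "norm (LINT x|M. f x * of_real (h k x)) \<le> (LINT x|M. norm (f x * of_real (h k x)))"
    by (rule integral_norm_bound)
  also have "\<dots> \<le> (LINT x|M. norm (f x))"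
  proof (rule integral_mono)
    show "integrable M (\<lambda>x. norm (f x * of_real (h k x)))"
      using integrable_mult_h[OF f, of k] by (rule integrable_norm)
    show "integrable M (\<lambda>x. norm (f x))" using Lp_integrable[OF f] by simp
    show "norm (f x * of_real (h k x)) \<le> norm (f x)" if "x \<in> space M" for x
      using h_bounded[OF that] by (simp add: norm_mult mult_left_le)
  qed
  also have "\<dots> \<le> (measure M (space M) + 1) * Lp_norm p M f" by (rule Lp_integral_norm_le[OF f])
  finally have "norm (coef k f) \<le> (measure M (space M) + 1) * Lp_norm p M f / (LINT x|M. (h k x)\<^sup>2)"
    by (simp add: coef_def norm_divide divide_right_mono)
  then show "norm (coef k f) \<le> ?D k * Lp_norm p M f" by simp
qed

lemma h_orthogonal:
  assumes "j < k"
  shows "(LINT x|M. h j x * h k x) = 0"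
proof -
  obtain c where c: "\<And>x. x \<in> space M \<Longrightarrow> h j x * h k x = c * h k x"
  proof (cases "\<exists>z\<in>space M. h k z \<noteq> 0")
    case True
    then obtain z where z: "z \<in> space M" "h k z \<noteq> 0" by blast
    show ?thesis using h_const_on_support[OF assms _ z(1) _ z(2)] by (intro that[of "h j z"]) auto
  next
    case False
    then show ?thesis by (intro that[of 0]) auto
  qed
  have "(LINT x|M. h j x * h k x) = (LINT x|M. c * h k x)"
    using c by (intro Bochner_Integration.integral_cong) auto
  then show ?thesis using h_mean_zero[of k] assms by simp
qed

lemma coef_h: "coef k (\<lambda>x. of_real (h j x)) = (if j = k \<and> (LINT x|M. (h k x)\<^sup>2) \<noteq> 0 then 1 else 0)"
proof -
  have "(LINT x|M. of_real (h j x) * of_real (h k x)) = (of_real (LINT x|M. h j x * h k x) :: complex)"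
    by (simp only: of_real_mult[symmetric] integral_complex_of_real)
  moreover have "(LINT x|M. h j x * h k x) = 0" if "j \<noteq> k"
    using h_orthogonal[of j k] h_orthogonal[of k j] that by (cases "j < k") (auto simp: mult.commute)
  ultimately show ?thesis by (auto simp: coef_def power2_eq_square)
qed

lemma coef_sum_h:
  "coef k (\<lambda>x. \<Sum>j<n. a j * of_real (h j x)) = (if k < n \<and> (LINT x|M. (h k x)\<^sup>2) \<noteq> 0 then a k else 0)"
proof -
  have "coef k (\<lambda>x. \<Sum>j<n. a j * of_real (h j x)) = (\<Sum>j<n. a j * coef k (\<lambda>x. of_real (h j x)))"
    by (subst coef_sum) (auto simp: coef_cmult intro: Lp_cmult Lp_h)
  also have "\<dots> = (\<Sum>j<n. if j = k then (if (LINT x|M. (h k x)\<^sup>2) \<noteq> 0 then a k else 0) else 0)"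
    unfolding coef_h by (intro sum.cong) auto
  finally show ?thesis by simp
qed

text \<open>
  The coefficients reproduce a finite combination term by term. Only almost everywhere, because the
  coefficient of a function \<open>h k\<close> that is zero almost everywhere is lost.
\<close>

lemma AE_coef_sum_h:
  "AE x in M. \<forall>k. coef k (\<lambda>x. \<Sum>j<n. a j * of_real (h j x)) * of_real (h k x)
       = (if k < n then a k * of_real (h k x) else 0)"
proof -
  have "AE x in M. (LINT x|M. (h k x)\<^sup>2) = 0 \<longrightarrow> h k x = 0" for k
  proof (cases "(LINT x|M. (h k x)\<^sup>2) = 0")
    case True
    have "integrable M (\<lambda>x. (h k x)\<^sup>2)"
      using h_bounded by (intro integrable_const_bound[of _ 1]) (auto simp: abs_square_le_1)
    then have "AE x in M. (h k x)\<^sup>2 = 0" using True integral_nonneg_eq_0_iff_AE[of M "\<lambda>x. (h k x)\<^sup>2"] by auto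
    then show ?thesis by auto
  qed auto
  then have "AE x in M. \<forall>k. (LINT x|M. (h k x)\<^sup>2) = 0 \<longrightarrow> h k x = 0" by (subst AE_all_countable) auto
  then show ?thesis by eventually_elim (auto simp: coef_sum_h)
qed

end

locale haar_like_system = martingale_difference_system +
  assumes h_dense: "\<And>f e. f \<in> Lp_space p M \<Longrightarrow> 0 < e \<Longrightarrow>
     \<exists>n a. Lp_norm p M (\<lambda>x. f x - (\<Sum>k<n. a k * of_real (h k x))) < e"
begin

text \<open>
  For finite combinations this is the unconditionality estimate. The general case follows by density,
  since for a fixed finite set \<open>F\<close> the left-hand side is continuous in \<open>f\<close>.
\<close>

lemma partial_sum_bound:
  obtains C where "0 \<le> C"
    "\<And>f F. f \<in> Lp_space p M \<Longrightarrow> finite F \<Longrightarrow>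
       Lp_norm p M (\<lambda>x. \<Sum>k\<in>F. coef k f * of_real (h k x)) \<le> C * Lp_norm p M f"
proof -
  obtain C where C0: "0 \<le> C" and C: "\<And>(a :: nat \<Rightarrow> complex) (n :: nat) F. F \<subseteq> {..<n} \<Longrightarrow>
      Lp_norm p M (\<lambda>x. \<Sum>k\<in>F. a k * of_real (h k x)) \<le> C * Lp_norm p M (\<lambda>x. \<Sum>k<n. a k * of_real (h k x))"
    using subset_sum_bound by blast
  obtain D where D0: "\<And>k. 0 \<le> D k" and D: "\<And>k f. f \<in> Lp_space p M \<Longrightarrow> norm (coef k f) \<le> D k * Lp_norm p M f"
    using coef_bound by blast
  show ?thesis
  proof (rule that[OF C0])
    fix f F assume f: "f \<in> Lp_space p M" and F: "finite (F :: nat set)"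
    define B where "B = (\<Sum>k\<in>F. D k * Lp_norm p M (\<lambda>x. of_real (h k x)))"
    have B: "B \<ge> 0" unfolding B_def using D0 Lp_norm_nonneg by (intro sum_nonneg mult_nonneg_nonneg)
    show "Lp_norm p M (\<lambda>x. \<Sum>k\<in>F. coef k f * of_real (h k x)) \<le> C * Lp_norm p M f"
    proof (rule field_le_epsilon)
      fix e :: real assume e: "0 < e"
      define d where "d = e / (B + C + 1)"
      have d: "d > 0" "d * (B + C) \<le> e" using e B C0 by (auto simp: d_def field_simps)
      obtain n a where close: "Lp_norm p M (\<lambda>x. f x - (\<Sum>k<n. a k * of_real (h k x))) < d"
        using h_dense[OF f d(1)] by blast
      define g where "g = (\<lambda>x. \<Sum>k<n. a k * of_real (h k x))"
      have g: "g \<in> Lp_space p M" unfolding g_def by (rule Lp_sum_h)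
      have fg: "(\<lambda>x. f x - g x) \<in> Lp_space p M" using f g by (rule Lp_diff)
      have 1: "Lp_norm p M (\<lambda>x. \<Sum>k\<in>F. coef k (\<lambda>x. f x - g x) * of_real (h k x)) \<le> d * B"
      proof -
        have "Lp_norm p M (\<lambda>x. \<Sum>k\<in>F. coef k (\<lambda>x. f x - g x) * of_real (h k x))
            \<le> (\<Sum>k\<in>F. Lp_norm p M (\<lambda>x. coef k (\<lambda>x. f x - g x) * of_real (h k x)))"
          by (intro Lp_norm_sum Lp_cmult Lp_h)
        also have "\<dots> \<le> (\<Sum>k\<in>F. d * (D k * Lp_norm p M (\<lambda>x. of_real (h k x))))"
        proof (rule sum_mono)
          fix k
          have "norm (coef k (\<lambda>x. f x - g x)) \<le> D k * Lp_norm p M (\<lambda>x. f x - g x)" using D[OF fg] .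
          also have "\<dots> \<le> D k * d" using close D0 by (intro mult_left_mono) (auto simp: g_def)
          finally have "norm (coef k (\<lambda>x. f x - g x)) * Lp_norm p M (\<lambda>x. of_real (h k x))
              \<le> D k * d * Lp_norm p M (\<lambda>x. of_real (h k x))"
            by (intro mult_right_mono Lp_norm_nonneg)
          then show "Lp_norm p M (\<lambda>x. coef k (\<lambda>x. f x - g x) * of_real (h k x)) \<le> d * (D k * Lp_norm p M (\<lambda>x. of_real (h k x)))"
            unfolding Lp_norm_cmult by (simp only: mult_ac)
        qed
        also have "\<dots> = d * B" by (simp add: B_def sum_distrib_left)
        finally show ?thesis .
      qed
      have 2: "Lp_norm p M (\<lambda>x. \<Sum>k\<in>F. coef k g * of_real (h k x)) \<le> C * (Lp_norm p M f + d)"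
      proof -
        have "AE x in M. (\<Sum>k\<in>F. coef k g * of_real (h k x)) = (\<Sum>k\<in>F \<inter> {..<n}. a k * of_real (h k x))"
          using AE_coef_sum_h[of a n]
        proof eventually_elim
          case (elim x)
          then have "(\<Sum>k\<in>F. coef k g * of_real (h k x)) = (\<Sum>k\<in>F. if k \<in> {..<n} then a k * of_real (h k x) else 0)"
            by (intro sum.cong) (auto simp: g_def)
          also have "\<dots> = (\<Sum>k\<in>F \<inter> {..<n}. a k * of_real (h k x))"
            using F by (rule sum.inter_restrict[symmetric])
          finally show ?case .
        qed
        then have "Lp_norm p M (\<lambda>x. \<Sum>k\<in>F. coef k g * of_real (h k x)) =
          Lp_norm p M (\<lambda>x. \<Sum>k\<in>F \<inter> {..<n}. a k * of_real (h k x))"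
          by (intro Lp_norm_cong_AE) auto
        also have "\<dots> \<le> C * Lp_norm p M g" unfolding g_def by (intro C) auto
        also have "\<dots> \<le> C * (Lp_norm p M f + d)"
        proof (intro mult_left_mono C0)
          have "Lp_norm p M (\<lambda>x. f x + (g x - f x)) \<le> Lp_norm p M f + Lp_norm p M (\<lambda>x. g x - f x)"
            by (intro Lp_norm_triangle f Lp_diff g)
          then show "Lp_norm p M g \<le> Lp_norm p M f + d"
            using close Lp_norm_minus_commute[of f g] by (simp add: g_def)
        qed
        finally show ?thesis .
      qed
      have "(\<lambda>x. \<Sum>k\<in>F. coef k f * of_real (h k x)) = (\<lambda>x. (\<Sum>k\<in>F. coef k (\<lambda>x. f x - g x) * of_real (h k x))
            + (\<Sum>k\<in>F. coef k g * of_real (h k x)))"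
        by (simp add: coef_diff[OF f g] sum.distrib[symmetric] left_diff_distrib)
      then have "Lp_norm p M (\<lambda>x. \<Sum>k\<in>F. coef k f * of_real (h k x)) \<le> d * B + C * (Lp_norm p M f + d)"
        using Lp_norm_triangle[OF Lp_sum_h[of "\<lambda>k. coef k (\<lambda>x. f x - g x)" F] Lp_sum_h[of "\<lambda>k. coef k g" F]] 1 2
        by simp
      also have "\<dots> = C * Lp_norm p M f + d * (B + C)" by (simp add: algebra_simps)
      finally show "Lp_norm p M (\<lambda>x. \<Sum>k\<in>F. coef k f * of_real (h k x)) \<le> C * Lp_norm p M f + e"
        using d by simp
    qed
  qed
qed

end

section \<open>Unimodular averages\<close>

text \<open>
  A function with null level sets is a convenient form of nonatomicity: its sublevel sets grow
  continuously in measure, so that any set can be cut at any prescribed proportion.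
\<close>

locale nonatomic_Lp_finite_measure = Lp_finite_measure M p for M :: "'a measure" and p :: real +
  fixes \<tau> :: "'a \<Rightarrow> real"
  assumes \<tau>_measurable [measurable]: "\<tau> \<in> borel_measurable M"
    and \<tau>_nonneg: "\<And>x. x \<in> space M \<Longrightarrow> 0 \<le> \<tau> x"
    and \<tau>_level_null: "\<And>t. AE x in M. \<tau> x \<noteq> t"
begin

lemma integrable_weighted:
  fixes w \<phi> :: "'a \<Rightarrow> real"
  assumes w: "integrable M w" and [measurable]: "E \<in> sets M" "\<phi> \<in> borel_measurable M"
    and \<phi>: "\<And>x. x \<in> space M \<Longrightarrow> \<bar>\<phi> x\<bar> \<le> 1"
  shows "integrable M (\<lambda>x. indicator E x * w x * \<phi> x)"
proof (rule Bochner_Integration.integrable_bound[OF w])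
  show "(\<lambda>x. indicator E x * w x * \<phi> x) \<in> borel_measurable M" using w by measurable
  have "norm (indicator E x * w x * \<phi> x) \<le> norm (w x)" if "x \<in> space M" for x
    using \<phi>[OF that] by (simp add: indicator_def abs_mult mult_left_le)
  then show "AE x in M. norm (indicator E x * w x * \<phi> x) \<le> norm (w x)" by auto
qed

text \<open>
  The weighted measure of \<open>E\<close> intersected with a sublevel set of \<open>\<tau>\<close> is continuous in the level and
  grows from \<open>0\<close> to the full measure; the intermediate value theorem applies.
\<close>

lemma halving:
  fixes w :: "'a \<Rightarrow> real"
  assumes w: "integrable M w" "\<And>x. x \<in> space M \<Longrightarrow> 0 \<le> w x" and E [measurable]: "E \<in> sets M"
  obtains E' where "E' \<in> sets M" "E' \<subseteq> E"
    "(LINT x|M. indicator E' x * w x) = (LINT x|M. indicator E x * w x) / 2"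
proof -
  define G where "G t = (LINT x|M. indicator E x * w x * (if \<tau> x \<le> t then 1 else 0))" for t
  define W where "W = (LINT x|M. indicator E x * w x)"
  have [measurable]: "w \<in> borel_measurable M" using w by auto
  have dct: "(\<lambda>n. G (t n)) \<longlonglongrightarrow> (LINT x|M. indicator E x * w x * \<phi> x)"
    if lim: "AE x in M. (\<lambda>n. if \<tau> x \<le> t n then 1 else 0) \<longlonglongrightarrow> \<phi> x" and [measurable]: "\<phi> \<in> borel_measurable M"
    for t :: "nat \<Rightarrow> real" and \<phi> :: "'a \<Rightarrow> real"
    unfolding G_def
  proof (rule integral_dominated_convergence[where w = "\<lambda>x. norm (w x)"])
    show "integrable M (\<lambda>x. norm (w x))" using w by simp
    show "AE x in M. (\<lambda>n. indicator E x * w x * (if \<tau> x \<le> t n then 1 else 0)) \<longlonglongrightarrow> indicator E x * w x * \<phi> x"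
      using lim by eventually_elim (intro tendsto_mult tendsto_const)
  qed (auto simp: indicator_def)
  have cont: "isCont G t" for t
    unfolding continuous_at_sequentially comp_def
  proof (intro allI impI)
    fix u assume u: "u \<longlonglongrightarrow> t"
    show "(\<lambda>n. G (u n)) \<longlonglongrightarrow> G t"
      unfolding G_def[of t]
    proof (rule dct)
      show "AE x in M. (\<lambda>n. if \<tau> x \<le> u n then 1 else 0) \<longlonglongrightarrow> (if \<tau> x \<le> t then 1 else 0 :: real)"
        using \<tau>_level_null[of t]
      proof eventually_elim
        case (elim x)
        consider "\<tau> x < t" | "t < \<tau> x" using elim by linarith
        then have "\<forall>\<^sub>F n in sequentially. (if \<tau> x \<le> u n then 1 else 0) = (if \<tau> x \<le> t then 1 else 0 :: real)"
        proof cases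
          case 1
          then show ?thesis using order_tendstoD(1)[OF u 1] by (auto elim: eventually_mono)
        next
          case 2
          then show ?thesis using order_tendstoD(2)[OF u 2] by (auto elim: eventually_mono)
        qed
        then show ?case by (rule tendsto_eventually)
      qed
    qed measurable
  qed
  have lim: "(\<lambda>n. G (real n)) \<longlonglongrightarrow> W"
  proof -
    have "(\<lambda>n. G (real n)) \<longlonglongrightarrow> (LINT x|M. indicator E x * w x * 1)"
    proof (rule dct)
      have "\<forall>\<^sub>F n in sequentially. (if \<tau> x \<le> real n then 1 else 0) = (1::real)" for x
      proof -
        have "\<forall>\<^sub>F n in sequentially. \<tau> x \<le> real n"
          by (metis eventually_at_top_linorder filterlim_at_top filterlim_real_sequentially)
        then show ?thesis by eventually_elim simp
      qed
      then show "AE x in M. (\<lambda>n. if \<tau> x \<le> real n then 1 else 0) \<longlonglongrightarrow> (1::real)"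
        by (intro AE_I2 tendsto_eventually)
    qed auto
    then show ?thesis by (simp add: W_def)
  qed
  have W: "W \<ge> 0" unfolding W_def using w by (intro Bochner_Integration.integral_nonneg) (auto simp: indicator_def)
  have G0: "G (- 1) = 0"
  proof -
    have "G (- 1) = (LINT x|M. 0)" unfolding G_def
      using \<tau>_nonneg by (intro Bochner_Integration.integral_cong) (force simp: indicator_def)+
    then show ?thesis by simp
  qed
  obtain t where t: "G t = W / 2"
  proof (cases "W = 0")
    case True
    then show ?thesis using G0 by (intro that[of "-1"]) auto
  next
    case False
    then have "\<forall>\<^sub>F n in sequentially. W / 2 < G (real n)" using W by (intro order_tendstoD(1)[OF lim]) auto
    then obtain n where "W / 2 < G (real n)" by (auto simp: eventually_sequentially)
    then have "\<exists>t\<ge>-1. t \<le> real n \<and> G t = W / 2"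
      using G0 W cont by (intro IVT) auto
    then show ?thesis using that by blast
  qed
  show ?thesis
  proof (rule that[of "{x \<in> space M. x \<in> E \<and> \<tau> x \<le> t}"])
    have "(LINT x|M. indicator {x \<in> space M. x \<in> E \<and> \<tau> x \<le> t} x * w x) = G t"
      unfolding G_def by (intro Bochner_Integration.integral_cong) (auto simp: indicator_def)
    then show "(LINT x|M. indicator {x \<in> space M. x \<in> E \<and> \<tau> x \<le> t} x * w x) = (LINT x|M. indicator E x * w x) / 2"
      using t by (simp add: W_def)
  qed auto
qed

text \<open>
  Rademacher functions for the weight \<open>w\<close>, built by cutting \<open>E\<close> into two halves of equal weight and
  using the induction hypothesis on each. The new function is \<open>1\<close> on one half and \<open>-1\<close> on the other;
  it is orthogonal to the previous ones because these have mean zero on each half. This is why mean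
  zero is part of the statement.
\<close>

lemma rademacher_on:
  fixes w :: "'a \<Rightarrow> real"
  assumes w: "integrable M w" "\<And>x. x \<in> space M \<Longrightarrow> 0 \<le> w x"
  shows "E \<in> sets M \<Longrightarrow> \<exists>r :: nat \<Rightarrow> 'a \<Rightarrow> real. (\<forall>j. r j \<in> borel_measurable M) \<and> (\<forall>j x. \<bar>r j x\<bar> = 1) \<and>
    (\<forall>j<n. (LINT x|M. indicator E x * w x * r j x) = 0) \<and>
    (\<forall>j<n. \<forall>k<j. (LINT x|M. indicator E x * w x * (r j x * r k x)) = 0)"
proof (induction n arbitrary: E)
  case 0
  then show ?case by (intro exI[of _ "\<lambda>_ _. 1"]) auto
next
  case (Suc n)
  note [measurable] = Suc.prems
  obtain A where A [measurable]: "A \<in> sets M" and "A \<subseteq> E"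
    and half: "(LINT x|M. indicator A x * w x) = (LINT x|M. indicator E x * w x) / 2"
    using halving[OF w Suc.prems] by blast
  obtain r where r [measurable]: "\<And>j. r j \<in> borel_measurable M" and r1: "\<And>j x. \<bar>r j x\<bar> = 1"
    and r0: "\<And>j. j < n \<Longrightarrow> (LINT x|M. indicator A x * w x * r j x) = 0"
    and rr: "\<And>j k. j < n \<Longrightarrow> k < j \<Longrightarrow> (LINT x|M. indicator A x * w x * (r j x * r k x)) = 0"
    using Suc.IH[of A] A by blast
  obtain s where s [measurable]: "\<And>j. s j \<in> borel_measurable M" and s1: "\<And>j x. \<bar>s j x\<bar> = 1"
    and s0: "\<And>j. j < n \<Longrightarrow> (LINT x|M. indicator (E - A) x * w x * s j x) = 0"
    and ss: "\<And>j k. j < n \<Longrightarrow> k < j \<Longrightarrow> (LINT x|M. indicator (E - A) x * w x * (s j x * s k x)) = 0"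
    using Suc.IH[of "E - A"] Suc.prems A by blast
  have split: "(LINT x|M. indicator E x * w x * (if x \<in> A then \<phi> x else \<psi> x)) =
      (LINT x|M. indicator A x * w x * \<phi> x) + (LINT x|M. indicator (E - A) x * w x * \<psi> x)"
    if [measurable]: "\<phi> \<in> borel_measurable M" "\<psi> \<in> borel_measurable M"
      and "\<And>x. \<bar>\<phi> x\<bar> \<le> 1" "\<And>x. \<bar>\<psi> x\<bar> \<le> 1" for \<phi> \<psi> :: "'a \<Rightarrow> real"
  proof -
    have "(LINT x|M. indicator E x * w x * (if x \<in> A then \<phi> x else \<psi> x)) =
      (LINT x|M. indicator A x * w x * \<phi> x + indicator (E - A) x * w x * \<psi> x)"
      using \<open>A \<subseteq> E\<close> by (intro Bochner_Integration.integral_cong) (auto simp: indicator_def)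
    also have "\<dots> = (LINT x|M. indicator A x * w x * \<phi> x) + (LINT x|M. indicator (E - A) x * w x * \<psi> x)"
      using that w by (intro Bochner_Integration.integral_add integrable_weighted) auto
    finally show ?thesis .
  qed
  define q where "q j x = (if x \<in> A then (if j = n then 1 else r j x) else (if j = n then - 1 else s j x))" for j x
  have one: "(LINT x|M. indicator A x * w x * 1) + (LINT x|M. indicator (E - A) x * w x * (- 1)) = 0"
    using split[of "\<lambda>_. 1" "\<lambda>_. 1"] half by simp
  have "q j \<in> borel_measurable M" for j
    unfolding q_def by measurable
  moreover have "\<bar>q j x\<bar> = 1" for j x using r1 s1 by (simp add: q_def)
  moreover have "(LINT x|M. indicator E x * w x * q j x) = 0" if "j < Suc n" for j
    unfolding q_def using that r0 s0 one r1 s1 by (subst split) (auto simp: less_Suc_eq)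
  moreover have "(LINT x|M. indicator E x * w x * (q j x * q k x)) = 0" if "j < Suc n" "k < j" for j k
  proof -
    have eq: "q j x * q k x = (if x \<in> A then (if j = n then r k x else r j x * r k x)
          else (if j = n then - s k x else s j x * s k x))" for x
      using that by (auto simp: q_def)
    show ?thesis unfolding eq using that r0[of k] s0[of k] rr[of j k] ss[of j k] r1 s1
      by (subst split) (auto simp: less_Suc_eq abs_mult)
  qed
  ultimately show ?case by (intro exI[of _ q]) auto
qed

text \<open>
  By orthogonality the square of the \<open>L\<^sup>2\<close> norm of \<open>T = (\<Sum>j\<in>G. r j) * s / m\<close> is at most
  \<open>\<mu> / m\<close>, for every \<open>G\<close>. Since \<open>\<bar>T\<bar> \<le> 1\<close>, one has \<open>\<bar>T\<bar> powr p \<le> \<eta> powr p + T\<^sup>2 / \<eta>\<^sup>2\<close> for every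
  \<open>\<eta> > 0\<close>, so smallness in \<open>L\<^sup>2\<close> gives smallness in \<open>L\<^sup>p\<close>, whether \<open>p\<close> is below or above \<open>2\<close>.
\<close>

lemma rademacher_averages_small:
  fixes s :: "'a \<Rightarrow> real"
  assumes [measurable]: "s \<in> borel_measurable M" and s: "\<And>x. x \<in> space M \<Longrightarrow> \<bar>s x\<bar> \<le> 1" and \<delta>: "0 < \<delta>"
  obtains m :: nat and r :: "nat \<Rightarrow> 'a \<Rightarrow> real" where "0 < m" "\<And>j. r j \<in> borel_measurable M" "\<And>j x. \<bar>r j x\<bar> = 1"
    "\<And>G. G \<subseteq> {..<m} \<Longrightarrow> Lp_norm p M (\<lambda>x. of_real ((\<Sum>j\<in>G. r j x) * s x / m)) \<le> \<delta>"
proof -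
  define \<mu> where "\<mu> = measure M (space M)"
  have \<mu>: "\<mu> \<ge> 0" by (simp add: \<mu>_def)
  \<comment> \<open>The choice of \<open>\<eta>\<close> makes the contribution of \<open>\<eta> powr p\<close> at most \<open>\<delta> powr p / 2\<close>; then \<open>m\<close> is
    taken large enough to do the same for \<open>T\<^sup>2 / \<eta>\<^sup>2\<close>.\<close>
  define \<eta> where "\<eta> = (\<delta> powr p / (2 * (\<mu> + 1))) powr (1 / p)"
  have \<eta>: "\<eta> > 0" using \<delta> \<mu> by (simp add: \<eta>_def)
  have \<eta>p: "\<eta> powr p * \<mu> \<le> \<delta> powr p / 2"
  proof -
    have "\<eta> powr p = \<delta> powr p / (2 * (\<mu> + 1))" using p_gt_1 \<mu> by (simp add: \<eta>_def powr_powr)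
    moreover have "\<mu> / (\<mu> + 1) \<le> 1" using \<mu> by simp
    ultimately show ?thesis using mult_left_mono[of "\<mu> / (\<mu> + 1)" 1 "\<delta> powr p / 2"] by simp
  qed
  obtain m0 :: nat where m0: "2 * \<mu> / (\<delta> powr p * \<eta>\<^sup>2) < m0" using reals_Archimedean2 by blast
  define m where "m = Suc m0"
  have m: "m > 0" "2 * \<mu> / (\<delta> powr p * \<eta>\<^sup>2) \<le> m" using m0 by (auto simp: m_def)
  have m_le: "\<mu> / m / \<eta>\<^sup>2 \<le> \<delta> powr p / 2"
    using m \<delta> \<eta> by (simp add: field_simps)
  define w where "w x = (s x)\<^sup>2" for x
  have w_int: "integrable M w" unfolding w_def
    using s by (intro integrable_const_bound[where B = 1]) (auto simp: abs_square_le_1)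
  have w_nonneg: "0 \<le> w x" for x by (simp add: w_def)
  have w_le: "(LINT x|M. w x) \<le> \<mu>"
  proof -
    have "(LINT x|M. w x) \<le> (LINT x|M. 1)"
      by (rule integral_mono[OF w_int]) (simp_all add: w_def abs_square_le_1 s)
    then show ?thesis by (simp add: \<mu>_def)
  qed
  obtain r where r [measurable]: "\<And>j. r j \<in> borel_measurable M" and r1: "\<And>j x. \<bar>r j x\<bar> = 1"
    and rr': "\<And>j k. j < m \<Longrightarrow> k < j \<Longrightarrow> (LINT x|M. indicator (space M) x * w x * (r j x * r k x)) = 0"
    using rademacher_on[OF w_int w_nonneg sets.top, of m] by blast
  have wr_int: "integrable M (\<lambda>x. w x * (r j x * r k x))" for j k
    using w_int r1
    by (intro Bochner_Integration.integrable_bound[OF w_int]) (auto simp: abs_mult)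
  have rr: "(LINT x|M. w x * (r j x * r k x)) = (if j = k then LINT x|M. w x else 0)" if "j < m" "k < m" for j k
  proof -
    have eq: "(LINT x|M. w x * (r j x * r k x)) = (LINT x|M. indicator (space M) x * w x * (r j x * r k x))" for j k
      by (intro Bochner_Integration.integral_cong) auto
    have sq: "r k x * r k x = 1" for x
      using r1[of k x] by (metis abs_mult_self_eq mult_1)
    consider "j = k" | "k < j" | "j < k" by linarith
    then show ?thesis
    proof cases
      case 1
      then show ?thesis using sq by simp
    next
      case 2
      then show ?thesis using rr'[of j k] that eq by simp
    next
      case 3
      then show ?thesis using rr'[of k j] that eq[of k j] by (simp add: mult.commute)
    qed
  qed
  show ?thesis
  proof (rule that[OF m(1) r r1])
    fix G assume G: "G \<subseteq> {..<m}"
    then have fin: "finite G" and card: "card G \<le> m" using finite_subset card_mono[of "{..<m}" G] by auto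
    define T where "T x = (\<Sum>j\<in>G. r j x) * s x / m" for x
    have [measurable]: "T \<in> borel_measurable M" unfolding T_def by measurable
    have T1: "\<bar>T x\<bar> \<le> 1" if "x \<in> space M" for x
    proof -
      have "\<bar>\<Sum>j\<in>G. r j x\<bar> \<le> (\<Sum>j\<in>G. \<bar>r j x\<bar>)" by (rule sum_abs)
      also have "\<dots> \<le> m" using card by (simp add: r1)
      finally have "\<bar>\<Sum>j\<in>G. r j x\<bar> * \<bar>s x\<bar> \<le> real m * 1" using s[OF that] by (intro mult_mono) auto
      then show ?thesis using m by (simp add: T_def abs_mult)
    qed
    have T2: "(T x)\<^sup>2 = (\<Sum>j\<in>G. \<Sum>k\<in>G. w x * (r j x * r k x)) / m\<^sup>2" for x
    proof -
      have "(\<Sum>j\<in>G. \<Sum>k\<in>G. w x * (r j x * r k x)) = w x * (\<Sum>j\<in>G. r j x)\<^sup>2"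
        by (simp only: power2_eq_square sum_product) (simp only: sum_distrib_left)
      then show ?thesis by (simp add: T_def w_def power_divide power_mult_distrib mult.commute)
    qed
    have T2_int: "integrable M (\<lambda>x. (T x)\<^sup>2)"
      unfolding T2 by (intro integrable_divide Bochner_Integration.integrable_sum wr_int)
    have "(LINT x|M. (T x)\<^sup>2) = (\<Sum>j\<in>G. \<Sum>k\<in>G. LINT x|M. w x * (r j x * r k x)) / m\<^sup>2"
      unfolding T2 using wr_int by simp
    also have "(\<Sum>j\<in>G. \<Sum>k\<in>G. LINT x|M. w x * (r j x * r k x)) = (\<Sum>j\<in>G. \<Sum>k\<in>G. if j = k then LINT x|M. w x else 0)"
      using G by (intro sum.cong refl rr) auto
    also have "\<dots> = card G * (LINT x|M. w x)" using fin by simp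
    also have "\<dots> / m\<^sup>2 \<le> m * \<mu> / m\<^sup>2" using card w_le
      by (intro divide_right_mono mult_mono) (auto simp: w_def)
    also have "\<dots> = \<mu> / m" using m by (simp add: power2_eq_square)
    finally have T2_le: "(LINT x|M. (T x)\<^sup>2) \<le> \<mu> / m" .
    have "(LINT x|M. norm (complex_of_real (T x)) powr p) \<le> (LINT x|M. \<eta> powr p + (T x)\<^sup>2 / \<eta>\<^sup>2)"
    proof (rule integral_mono)
      show "integrable M (\<lambda>x. norm (complex_of_real (T x)) powr p)"
        using T1 by (intro Lp_integrable_powr Lp_bounded[where B = 1]) auto
      show "integrable M (\<lambda>x. \<eta> powr p + (T x)\<^sup>2 / \<eta>\<^sup>2)" using T2_int by simp
      fix x assume x: "x \<in> space M"
      show "norm (complex_of_real (T x)) powr p \<le> \<eta> powr p + (T x)\<^sup>2 / \<eta>\<^sup>2"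
      proof (cases "\<bar>T x\<bar> \<le> \<eta>")
        case True
        then have "\<bar>T x\<bar> powr p \<le> \<eta> powr p" using p_gt_1 by (intro powr_mono2) auto
        then show ?thesis by (simp add: add_increasing2)
      next
        case False
        have "\<bar>T x\<bar> powr p \<le> 1 powr p" using T1[OF x] p_gt_1 by (intro powr_mono2) auto
        moreover have "1 \<le> (T x)\<^sup>2 / \<eta>\<^sup>2" using False \<eta> abs_le_square_iff[of \<eta> "T x"] by simp
        ultimately show ?thesis by (simp add: add_increasing)
      qed
    qed
    also have "\<dots> = \<eta> powr p * \<mu> + (LINT x|M. (T x)\<^sup>2) / \<eta>\<^sup>2" using T2_int by (simp add: \<mu>_def)
    also have "\<dots> \<le> \<delta> powr p / 2 + \<mu> / m / \<eta>\<^sup>2"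
      using \<eta>p T2_le by (intro add_mono divide_right_mono) auto
    also have "\<dots> \<le> \<delta> powr p"
      using add_left_mono[OF m_le, of "\<delta> powr p / 2"] by (simp only: field_sum_of_halves)
    finally show "Lp_norm p M (\<lambda>x. of_real ((\<Sum>j\<in>G. r j x) * s x / m)) \<le> \<delta>"
      unfolding T_def using \<delta> by (intro Lp_norm_leI) auto
  qed
qed

text \<open>
  The functions are \<open>v i = u + \<i> * \<rho> i * sqrt (1 - u\<^sup>2)\<close>. Every sign function is used together with its
  negative, so that the full average is exactly \<open>u\<close>.
\<close>

lemma unimodular_average:
  fixes u :: "'a \<Rightarrow> real"
  assumes [measurable]: "u \<in> borel_measurable M" and u: "\<And>x. x \<in> space M \<Longrightarrow> \<bar>u x\<bar> \<le> 1" and \<delta>: "0 < \<delta>"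
  obtains N :: nat and v :: "nat \<Rightarrow> 'a \<Rightarrow> complex" where "0 < N" "\<And>i. v i \<in> borel_measurable M"
    "\<And>i x. x \<in> space M \<Longrightarrow> norm (v i x) = 1"
    "\<And>x. (\<Sum>i<N. v i x) = of_nat N * of_real (u x)"
    "\<And>F. F \<subseteq> {..<N} \<Longrightarrow> Lp_norm p M (\<lambda>x. (\<Sum>i\<in>F. v i x - of_real (u x)) / of_nat N) \<le> \<delta>"
proof -
  define s where "s x = sqrt (1 - (u x)\<^sup>2)" for x
  have s_meas [measurable]: "s \<in> borel_measurable M" unfolding s_def by measurable
  have s: "\<bar>s x\<bar> \<le> 1" "(s x)\<^sup>2 = 1 - (u x)\<^sup>2" if "x \<in> space M" for x
    using u[OF that] by (auto simp: s_def abs_square_le_1)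
  obtain m :: nat and r :: "nat \<Rightarrow> 'a \<Rightarrow> real" where m: "0 < m" and r [measurable]: "\<And>j. r j \<in> borel_measurable M"
    and r1: "\<And>j x. \<bar>r j x\<bar> = 1"
    and small: "\<And>G. G \<subseteq> {..<m} \<Longrightarrow> Lp_norm p M (\<lambda>x. of_real ((\<Sum>j\<in>G. r j x) * s x / m)) \<le> \<delta>"
    using rademacher_averages_small[OF s_meas s(1) \<delta>] by blast
  define \<rho> where "\<rho> i x = (if i < m then r i x else - r (i - m) x)" for i x
  define v where "v i x = Complex (u x) (\<rho> i x * s x)" for i x
  have \<rho>sum: "(\<Sum>i\<in>F. \<rho> i x) = (\<Sum>j\<in>F \<inter> {..<m}. r j x) - (\<Sum>j\<in>{j. j + m \<in> F}. r j x)" if "finite F" for F x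
  proof -
    have "(\<Sum>i\<in>F. \<rho> i x) = (\<Sum>j\<in>F \<inter> {..<m}. \<rho> j x) + (\<Sum>j\<in>F - {..<m}. \<rho> j x)"
      using that by (rule sum.Int_Diff)
    also have "(\<Sum>j\<in>F - {..<m}. \<rho> j x) = (\<Sum>j\<in>{j. j + m \<in> F}. - r j x)"
      by (rule sum.reindex_bij_witness[of _ "\<lambda>j. j + m" "\<lambda>i. i - m"]) (auto simp: \<rho>_def)
    finally show ?thesis by (simp add: \<rho>_def sum_negf)
  qed
  have v_eq: "v i x = of_real (u x) + \<i> * of_real (\<rho> i x * s x)" for i x
    by (simp add: v_def complex_eq_iff)
  show ?thesis
  proof (rule that[of "m + m" v])
    show "0 < m + m" using m by simp
    show "v i \<in> borel_measurable M" for i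
      unfolding v_eq \<rho>_def by measurable
    show "norm (v i x) = 1" if "x \<in> space M" for i x
    proof -
      have "(\<rho> i x)\<^sup>2 = 1" using r1 by (auto simp: \<rho>_def abs_square_eq_1)
      then show ?thesis using s(2)[OF that] by (simp add: v_def cmod_def power_mult_distrib)
    qed
    show "(\<Sum>i<m + m. v i x) = of_nat (m + m) * of_real (u x)" for x
    proof -
      have "{j. j + m \<in> {..<m + m}} = {..<m}" "{..<m + m} \<inter> {..<m} = {..<m}" by auto
      then have "(\<Sum>i<m + m. \<rho> i x) = 0" using \<rho>sum[of "{..<m + m}" x] by simp
      then have "(\<Sum>i<m + m. \<i> * of_real (\<rho> i x * s x)) = 0"
        by (simp add: sum_distrib_left[symmetric] sum_distrib_right[symmetric] flip: of_real_sum)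
      then show ?thesis unfolding v_eq sum.distrib by simp
    qed
    fix F assume F: "F \<subseteq> {..<m + m}"
    then have fin: "finite F" using finite_subset by auto
    define T where "T G x = complex_of_real ((\<Sum>j\<in>G. r j x) * s x / m)" for G x
    have T: "T G \<in> Lp_space p M" if "G \<subseteq> {..<m}" for G
    proof (rule Lp_bounded[where B = "card G / m"])
      show "T G \<in> borel_measurable M" unfolding T_def by measurable
      fix x assume x: "x \<in> space M"
      have "\<bar>\<Sum>j\<in>G. r j x\<bar> \<le> (\<Sum>j\<in>G. \<bar>r j x\<bar>)" by (rule sum_abs)
      then have "\<bar>\<Sum>j\<in>G. r j x\<bar> * \<bar>s x\<bar> \<le> real (card G) * 1" using s(1)[OF x] by (intro mult_mono) (auto simp: r1)
      then show "norm (T G x) \<le> card G / m" using m by (simp add: T_def norm_divide norm_mult abs_mult divide_right_mono flip: of_real_sum)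
    qed
    have sub: "F \<inter> {..<m} \<subseteq> {..<m}" "{j. j + m \<in> F} \<subseteq> {..<m}" using F by auto
    have "(\<Sum>i\<in>F. v i x - of_real (u x)) / of_nat (m + m) = (\<i> / 2) * (T (F \<inter> {..<m}) x - T {j. j + m \<in> F} x)" for x
    proof -
      have eq: "(\<Sum>i\<in>F. v i x - of_real (u x)) = \<i> * of_real ((\<Sum>i\<in>F. \<rho> i x) * s x)"
        unfolding v_eq by (simp add: sum_distrib_left sum_distrib_right)
      show ?thesis unfolding eq \<rho>sum[OF fin] T_def using m by (simp add: field_simps)
    qed
    then have "Lp_norm p M (\<lambda>x. (\<Sum>i\<in>F. v i x - of_real (u x)) / of_nat (m + m))
        = 1 / 2 * Lp_norm p M (\<lambda>x. T (F \<inter> {..<m}) x - T {j. j + m \<in> F} x)"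
      by (simp only: Lp_norm_cmult) (simp add: norm_divide)
    also have "\<dots> \<le> 1 / 2 * (\<delta> + \<delta>)"
    proof -
      have "Lp_norm p M (\<lambda>x. T (F \<inter> {..<m}) x + (- 1) * T {j. j + m \<in> F} x) \<le>
          Lp_norm p M (T (F \<inter> {..<m})) + Lp_norm p M (\<lambda>x. (- 1) * T {j. j + m \<in> F} x)"
        by (intro Lp_norm_triangle Lp_cmult T sub)
      also have "\<dots> \<le> \<delta> + \<delta>"
        unfolding Lp_norm_cmult
        using small[OF sub(1), folded T_def] small[OF sub(2), folded T_def] by simp
      finally show ?thesis by simp
    qed
    finally show "Lp_norm p M (\<lambda>x. (\<Sum>i\<in>F. v i x - of_real (u x)) / of_nat (m + m)) \<le> \<delta>" by simp
  qed
qed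

end

section \<open>The frame obtained from a Haar system\<close>

context Lp_finite_measure begin

text \<open>
  Convergence of the finite partial sums along the directed set of finite index sets implies
  convergence of the series in every order.
\<close>

lemma unconditional_schauder_frameI:
  assumes g: "\<And>n. g n \<in> Lp_space p M"
    and add: "\<And>n f f'. f \<in> Lp_space p M \<Longrightarrow> f' \<in> Lp_space p M \<Longrightarrow> \<phi> n (\<lambda>x. f x + f' x) = \<phi> n f + \<phi> n f'"
    and cmult: "\<And>n c f. f \<in> Lp_space p M \<Longrightarrow> \<phi> n (\<lambda>x. c * f x) = c * \<phi> n f"
    and bounded: "\<And>n. \<exists>C. \<forall>f\<in>Lp_space p M. norm (\<phi> n f) \<le> C * Lp_norm p M f"
    and conv: "\<And>f e. f \<in> Lp_space p M \<Longrightarrow> 0 < e \<Longrightarrow> \<exists>G0. finite G0 \<and> (\<forall>G. finite G \<longrightarrow> G0 \<subseteq> G \<longrightarrow>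
        Lp_norm p M (\<lambda>x. (\<Sum>n\<in>G. \<phi> n f * g n x) - f x) < e)"
  shows "unconditional_schauder_frame p M g \<phi>"
proof -
  have sums: "Lp_sums p M (\<lambda>n x. \<phi> (\<sigma> n) f * g (\<sigma> n) x) f" if f: "f \<in> Lp_space p M" and \<sigma>: "bij \<sigma>" for f \<sigma>
    unfolding Lp_sums_def
  proof (rule LIMSEQ_I)
    fix e :: real assume "0 < e"
    then obtain G0 where G0: "finite G0" and lt: "\<And>G. finite G \<Longrightarrow> G0 \<subseteq> G \<Longrightarrow>
        Lp_norm p M (\<lambda>x. (\<Sum>n\<in>G. \<phi> n f * g n x) - f x) < e" using conv[OF f] by blast
    obtain N0 where N0: "inv \<sigma> ` G0 \<subseteq> {..<N0}"
      using finite_nat_bounded[of "inv \<sigma> ` G0"] G0 by auto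
    have "norm (Lp_norm p M (\<lambda>x. (\<Sum>n<N. \<phi> (\<sigma> n) f * g (\<sigma> n) x) - f x) - 0) < e" if "N \<ge> N0" for N
    proof -
      have "G0 \<subseteq> \<sigma> ` {..<N}"
      proof
        fix y assume "y \<in> G0"
        then have "inv \<sigma> y \<in> {..<N}" using N0 that by auto
        moreover have "y = \<sigma> (inv \<sigma> y)" using \<sigma> by (simp add: bij_is_surj surj_f_inv_f)
        ultimately show "y \<in> \<sigma> ` {..<N}" by blast
      qed
      moreover have "(\<Sum>n\<in>\<sigma> ` {..<N}. \<phi> n f * g n x) = (\<Sum>n<N. \<phi> (\<sigma> n) f * g (\<sigma> n) x)" for x
        using \<sigma> by (subst sum.reindex) (auto intro: inj_on_subset bij_is_inj)
      ultimately show ?thesis using lt[of "\<sigma> ` {..<N}"] by (simp add: Lp_norm_nonneg)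
    qed
    then show "\<exists>no. \<forall>n\<ge>no. norm (Lp_norm p M (\<lambda>x. (\<Sum>n<n. \<phi> (\<sigma> n) f * g (\<sigma> n) x) - f x) - 0) < e" by blast
  qed
  have "\<phi> n \<in> Lp_dual p M" for n unfolding Lp_dual_def using add cmult bounded by blast
  moreover have "Lp_sums p M (\<lambda>n x. \<phi> n f * g n x) f" if "f \<in> Lp_space p M" for f
    using sums[OF that bij_id] by simp
  ultimately show ?thesis
    unfolding unconditional_schauder_frame_def schauder_frame_def Lp_unconditionally_convergent_def
    using g sums by blast
qed

end

locale nonatomic_haar_like_system =
  haar_like_system M p h + nonatomic_Lp_finite_measure M p \<tau>
  for M :: "'a measure" and p :: real and h :: "nat \<Rightarrow> 'a \<Rightarrow> real" and \<tau> :: "'a \<Rightarrow> real"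
begin

theorem unimodular_unconditional_frame:
  "\<exists>g \<phi>. unconditional_schauder_frame p M g \<phi> \<and> (\<forall>n. \<forall>x\<in>space M. norm (g n x) = 1)"
proof -
  obtain C where C0: "0 \<le> C" and C: "\<And>f F. f \<in> Lp_space p M \<Longrightarrow> finite F \<Longrightarrow>
       Lp_norm p M (\<lambda>x. \<Sum>k\<in>F. coef k f * of_real (h k x)) \<le> C * Lp_norm p M f"
    using partial_sum_bound by blast
  obtain D where D0: "\<And>k. 0 \<le> D k" and D: "\<And>k f. f \<in> Lp_space p M \<Longrightarrow> norm (coef k f) \<le> D k * Lp_norm p M f"
    using coef_bound by blast
  \<comment> \<open>Errors of this size, multiplied by the bounds \<open>D k\<close> of the functionals, have sum at most \<open>2\<close>.\<close>
  define \<delta> where "\<delta> k = (1 / 2) ^ k / (D k + 1)" for k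
  have \<delta>: "\<delta> k > 0" for k using D0[of k] by (auto simp: \<delta>_def intro!: divide_pos_pos add_nonneg_pos)
  have D\<delta>: "D k * \<delta> k \<le> (1 / 2) ^ k" for k
  proof -
    have "D k / (D k + 1) \<le> 1" using D0[of k] by simp
    then show ?thesis using mult_left_mono[of "D k / (D k + 1)" 1 "(1 / 2) ^ k"]
      by (simp add: \<delta>_def mult.commute)
  qed
  define Q where "Q k m w \<longleftrightarrow> 0 < m \<and> (\<forall>i. w i \<in> borel_measurable M) \<and>
      (\<forall>i. \<forall>x\<in>space M. norm (w i x) = 1) \<and> (\<forall>x. (\<Sum>i<m. w i x) = of_nat m * of_real (h k x)) \<and>
      (\<forall>F\<subseteq>{..<m}. Lp_norm p M (\<lambda>x. (\<Sum>i\<in>F. w i x - of_real (h k x)) / of_nat m) \<le> \<delta> k)"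
    for k m and w :: "nat \<Rightarrow> 'a \<Rightarrow> complex"
  have "\<exists>m w. Q k m w" for k
    by (rule unimodular_average[OF h_measurable h_bounded \<delta>, of k k]) (unfold Q_def, blast+)
  then obtain N v where Q: "\<And>k. Q k (N k) (v k)" by metis
  have N: "0 < N k" and v [measurable]: "v k i \<in> borel_measurable M"
    and v1: "x \<in> space M \<Longrightarrow> norm (v k i x) = 1"
    and v_sum: "(\<Sum>i<N k. v k i x) = of_nat (N k) * of_real (h k x)"
    and v_small: "F \<subseteq> {..<N k} \<Longrightarrow> Lp_norm p M (\<lambda>x. (\<Sum>i\<in>F. v k i x - of_real (h k x)) / of_nat (N k)) \<le> \<delta> k"
    for k i x F
    using Q[of k] unfolding Q_def by blast+
  define G where "G n = (case prod_decode n of (k, i) \<Rightarrow> v k i)" for n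
  \<comment> \<open>Pairs \<open>(k, i)\<close> with \<open>i \<ge> N k\<close> get the zero functional, so that all pairs of natural numbers can
    serve as indices.\<close>
  define \<phi> where "\<phi> n f = (case prod_decode n of (k, i) \<Rightarrow> if i < N k then coef k f / of_nat (N k) else 0)" for n f
  have v_Lp: "v k i \<in> Lp_space p M" for k i
    using v1 by (intro Lp_bounded[where B = 1]) auto
  define idx where "idx S k = {i. i < N k \<and> prod_encode (k, i) \<in> S}" for S k
  define blk where "blk S f k x = coef k f / of_nat (N k) * (\<Sum>i\<in>idx S k. v k i x)" for S f k x
  have idx: "idx S k \<subseteq> {..<N k}" "finite (idx S k)" for S k by (auto simp: idx_def)
  \<comment> \<open>Regrouping a finite partial sum by \<open>k\<close>. The bound \<open>B\<close> may be enlarged at will, because blocks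
    without indices in \<open>S\<close> vanish.\<close>
  have blocks: "\<exists>B0. \<forall>B\<ge>B0. \<forall>f x. (\<Sum>n\<in>S. \<phi> n f * G n x) = (\<Sum>k<B. blk S f k x)" if S: "finite S" for S
  proof -
    define P where "P = prod_decode ` S"
    have P: "finite P" using S by (simp add: P_def)
    have mem: "(k, i) \<in> P \<longleftrightarrow> prod_encode (k, i) \<in> S" for k i
      unfolding P_def by (metis image_iff prod_decode_inverse prod_encode_inverse)
    obtain B0 where B0: "fst ` P \<subseteq> {..<B0}" using finite_nat_bounded[of "fst ` P"] P by auto
    have "(\<Sum>n\<in>S. \<phi> n f * G n x) = (\<Sum>k<B. blk S f k x)" if B: "B \<ge> B0" for B f x
    proof -
      define t where "t k i = (if i < N k then coef k f / of_nat (N k) else 0) * v k i x" for k i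
      have "(\<Sum>n\<in>S. \<phi> n f * G n x) = (\<Sum>n\<in>S. case prod_decode n of (k, i) \<Rightarrow> t k i)"
        by (intro sum.cong) (auto simp: \<phi>_def G_def t_def split: prod.splits)
      also have "\<dots> = (\<Sum>(k, i)\<in>P. t k i)"
        unfolding P_def by (subst sum.reindex) (auto simp: inj_prod_decode)
      also have "P = Sigma {..<B} (\<lambda>k. {i. (k, i) \<in> P})" using B0 B by force
      also have "(\<Sum>(k, i)\<in>Sigma {..<B} (\<lambda>k. {i. (k, i) \<in> P}). t k i) = (\<Sum>k<B. \<Sum>i | (k, i) \<in> P. t k i)"
      proof (rule sum.Sigma[symmetric])
        show "\<forall>k\<in>{..<B}. finite {i. (k, i) \<in> P}"
        proof
          fix k
          have "{i. (k, i) \<in> P} \<subseteq> snd ` P" by force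
          then show "finite {i. (k, i) \<in> P}" using P finite_subset by blast
        qed
      qed simp
      also have "\<dots> = (\<Sum>k<B. blk S f k x)"
      proof (rule sum.cong[OF refl])
        fix k
        have fin: "finite {i. (k, i) \<in> P}"
          by (rule finite_subset[of _ "snd ` P"]) (use P in force)+
        have "(\<Sum>i | (k, i) \<in> P. t k i) = (\<Sum>i\<in>idx S k. t k i)"
          using fin by (intro sum.mono_neutral_right) (auto simp: idx_def mem t_def)
        also have "\<dots> = blk S f k x"
          unfolding blk_def sum_distrib_left by (intro sum.cong) (auto simp: t_def idx_def)
        finally show "(\<Sum>i | (k, i) \<in> P. t k i) = blk S f k x" .
      qed
      finally show ?thesis .
    qed
    then show ?thesis by blast
  qed
  have bound: "Lp_norm p M (\<lambda>x. \<Sum>n\<in>S. \<phi> n f * G n x) \<le> (C + 2) * Lp_norm p M f"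
    if f: "f \<in> Lp_space p M" and S: "finite S" for f S
  proof -
    obtain B where B: "\<And>x. (\<Sum>n\<in>S. \<phi> n f * G n x) = (\<Sum>k<B. blk S f k x)"
      using blocks[OF S] by blast
    \<comment> \<open>The block of \<open>k\<close> is \<open>l k\<close> times the full term, up to the error of a partial unimodular average.\<close>
    define l where "l k = real (card (idx S k)) / real (N k)" for k
    have l: "0 \<le> l k \<and> l k \<le> 1" for k
      using card_mono[OF finite_lessThan idx(1)[of S k]] N[of k] by (simp add: l_def)
    define main where "main k x = coef k f * of_real (h k x)" for k x
    define err where "err k x = (\<Sum>i\<in>idx S k. v k i x - of_real (h k x)) / of_nat (N k)" for k x
    have err_Lp: "err k \<in> Lp_space p M" for k
      unfolding err_def using Lp_cmult[OF Lp_sum[OF Lp_diff[OF v_Lp Lp_h]], of "1 / of_nat (N k)"] by simp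
    have main_Lp: "main k \<in> Lp_space p M" for k unfolding main_def by (intro Lp_cmult Lp_h)
    have blk_eq: "blk S f k x = of_real (l k) * main k x + coef k f * err k x" for k x
      using N[of k] by (simp add: blk_def l_def main_def err_def sum_subtractf field_simps)
    have "Lp_norm p M (\<lambda>x. \<Sum>n\<in>S. \<phi> n f * G n x) =
       Lp_norm p M (\<lambda>x. (\<Sum>k<B. of_real (l k) * main k x) + (\<Sum>k<B. coef k f * err k x))"
      by (simp add: B blk_eq sum.distrib)
    also have "\<dots> \<le> Lp_norm p M (\<lambda>x. \<Sum>k<B. of_real (l k) * main k x) + Lp_norm p M (\<lambda>x. \<Sum>k<B. coef k f * err k x)"
      by (intro Lp_norm_triangle Lp_sum Lp_cmult main_Lp err_Lp)
    also have "Lp_norm p M (\<lambda>x. \<Sum>k<B. of_real (l k) * main k x) \<le> C * Lp_norm p M f"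
    proof (rule Lp_norm_multiplier_le)
      show "Lp_norm p M (\<lambda>x. \<Sum>k\<in>F. main k x) \<le> C * Lp_norm p M f" if "F \<subseteq> {..<B}" for F
        unfolding main_def using finite_subset[OF that] by (intro C f) auto
    qed (use l main_Lp in auto)
    also have "Lp_norm p M (\<lambda>x. \<Sum>k<B. coef k f * err k x) \<le> 2 * Lp_norm p M f"
    proof -
      have "Lp_norm p M (\<lambda>x. \<Sum>k<B. coef k f * err k x) \<le> (\<Sum>k<B. Lp_norm p M (\<lambda>x. coef k f * err k x))"
        by (intro Lp_norm_sum Lp_cmult err_Lp)
      also have "\<dots> \<le> (\<Sum>k<B. (1 / 2) ^ k * Lp_norm p M f)"
      proof (rule sum_mono)
        fix k
        have "norm (coef k f) * Lp_norm p M (err k) \<le> (D k * Lp_norm p M f) * \<delta> k"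
          unfolding err_def using D[OF f] v_small[OF idx(1)] D0 Lp_norm_nonneg
          by (intro mult_mono) auto
        also have "\<dots> = (D k * \<delta> k) * Lp_norm p M f" by simp
        also have "\<dots> \<le> (1 / 2) ^ k * Lp_norm p M f" by (intro mult_right_mono D\<delta> Lp_norm_nonneg)
        finally show "Lp_norm p M (\<lambda>x. coef k f * err k x) \<le> (1 / 2) ^ k * Lp_norm p M f"
          by (simp add: Lp_norm_cmult)
      qed
      also have "\<dots> = (\<Sum>k<B. (1 / 2) ^ k) * Lp_norm p M f" by (simp add: sum_distrib_right)
      also have "\<dots> \<le> 2 * Lp_norm p M f"
      proof (intro mult_right_mono Lp_norm_nonneg)
        have "(\<Sum>k<B. (1 / 2 :: real) ^ k) = ((1 / 2) ^ B - 1) / (1 / 2 - 1)"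
          by (rule geometric_sum) simp
        also have "\<dots> = 2 - 2 * (1 / 2) ^ B" by simp
        also have "\<dots> \<le> 2" by simp
        finally show "(\<Sum>k<B. (1 / 2 :: real) ^ k) \<le> 2" .
      qed
      finally show ?thesis .
    qed
    finally show ?thesis by (simp add: algebra_simps)
  qed
  have \<phi>_add: "\<phi> n (\<lambda>x. f x + f' x) = \<phi> n f + \<phi> n f'" if "f \<in> Lp_space p M" "f' \<in> Lp_space p M" for n f f'
    using that by (auto simp: \<phi>_def coef_add add_divide_distrib split: prod.splits)
  have \<phi>_cmult: "\<phi> n (\<lambda>x. c * f x) = c * \<phi> n f" for n c f
    by (auto simp: \<phi>_def coef_cmult split: prod.splits)
  have G_Lp: "G n \<in> Lp_space p M" for n using v_Lp by (simp add: G_def split: prod.splits)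
  have conv: "\<exists>G0. finite G0 \<and> (\<forall>S. finite S \<longrightarrow> G0 \<subseteq> S \<longrightarrow>
        Lp_norm p M (\<lambda>x. (\<Sum>n\<in>S. \<phi> n f * G n x) - f x) < e)" if f: "f \<in> Lp_space p M" and e: "0 < e" for f e
  proof -
    define d where "d = e / (C + 3)"
    have "d > 0" "d * (C + 3) = e" using e C0 by (simp_all add: d_def)
    then have d: "d > 0" "(C + 2) * d + d = e" by (simp_all add: algebra_simps)
    obtain n a where close: "Lp_norm p M (\<lambda>x. f x - (\<Sum>k<n. a k * of_real (h k x))) < d"
      using h_dense[OF f d(1)] by blast
    define f' where "f' = (\<lambda>x. \<Sum>k<n. a k * of_real (h k x))"
    have f': "f' \<in> Lp_space p M" unfolding f'_def by (rule Lp_sum_h)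
    have ff': "(\<lambda>x. f x - f' x) \<in> Lp_space p M" using f f' by (rule Lp_diff)
    define G0 where "G0 = prod_encode ` (SIGMA k:{..<n}. {..<N k})"
    have "Lp_norm p M (\<lambda>x. (\<Sum>n\<in>S. \<phi> n f * G n x) - f x) < e" if S: "finite S" "G0 \<subseteq> S" for S
    proof -
      obtain B0 where B0: "\<And>B f x. B \<ge> B0 \<Longrightarrow> (\<Sum>n\<in>S. \<phi> n f * G n x) = (\<Sum>k<B. blk S f k x)"
        using blocks[OF S(1)] by blast
      define B where "B = max n B0"
      have full: "idx S k = {..<N k}" if "k < n" for k
        using S(2) that by (auto simp: idx_def G0_def)
      have exact: "AE x in M. (\<Sum>n\<in>S. \<phi> n f' * G n x) = f' x"
        using AE_coef_sum_h[of a n]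
      proof eventually_elim
        case (elim x)
        have "blk S f' k x = (if k < n then a k * of_real (h k x) else 0)" for k
        proof (cases "k < n")
          case True
          then have "blk S f' k x = coef k f' * of_real (h k x)"
            using N[of k] by (simp add: blk_def full v_sum)
          then show ?thesis using elim True by (simp add: f'_def)
        next
          case False
          then have "coef k f' = 0" unfolding f'_def by (subst coef_sum_h) simp
          then show ?thesis using False by (simp add: blk_def)
        qed
        then have "(\<Sum>n\<in>S. \<phi> n f' * G n x) = (\<Sum>k<B. if k < n then a k * of_real (h k x) else 0)"
          using B0[of B] by (simp add: B_def)
        also have "\<dots> = f' x" unfolding f'_def
          by (rule sum.mono_neutral_cong_right) (auto simp: B_def)
        finally show ?case .
      qed
      have \<phi>_diff: "\<phi> n f = \<phi> n (\<lambda>x. f x - f' x) + \<phi> n f'" for n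
        using \<phi>_add[OF ff' f', of n] by simp
      have "AE x in M. (\<Sum>n\<in>S. \<phi> n f * G n x) - f x =
          (\<Sum>n\<in>S. \<phi> n (\<lambda>x. f x - f' x) * G n x) + (f' x - f x)"
        using exact by eventually_elim (simp add: \<phi>_diff distrib_right sum.distrib)
      then have "Lp_norm p M (\<lambda>x. (\<Sum>n\<in>S. \<phi> n f * G n x) - f x) =
          Lp_norm p M (\<lambda>x. (\<Sum>n\<in>S. \<phi> n (\<lambda>x. f x - f' x) * G n x) + (f' x - f x))"
        by (rule Lp_norm_cong_AE) (intro Lp_measurable Lp_add Lp_diff Lp_sum Lp_cmult G_Lp f f')+
      also have "\<dots> \<le> Lp_norm p M (\<lambda>x. \<Sum>n\<in>S. \<phi> n (\<lambda>x. f x - f' x) * G n x) + Lp_norm p M (\<lambda>x. f' x - f x)"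
        by (intro Lp_norm_triangle Lp_diff Lp_sum Lp_cmult G_Lp f f')
      also have "\<dots> \<le> (C + 2) * Lp_norm p M (\<lambda>x. f x - f' x) + Lp_norm p M (\<lambda>x. f x - f' x)"
        using bound[OF ff' S(1)] Lp_norm_minus_commute[of f f'] by simp
      also have "\<dots> < (C + 2) * d + d"
        using close C0 by (intro add_le_less_mono mult_left_mono) (auto simp: f'_def)
      finally show ?thesis using d by simp
    qed
    moreover have "finite G0" by (auto simp: G0_def)
    ultimately show ?thesis by blast
  qed
  have "unconditional_schauder_frame p M G \<phi>"
  proof (rule unconditional_schauder_frameI)
    fix n
    obtain k i where n: "prod_decode n = (k, i)" by fastforce
    have "norm (\<phi> n f) \<le> (D k / N k) * Lp_norm p M f" if "f \<in> Lp_space p M" for f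
      using D[OF that, of k] D0[of k] Lp_norm_nonneg[of f]
      by (auto simp: \<phi>_def n norm_divide divide_right_mono)
    then show "\<exists>C. \<forall>f\<in>Lp_space p M. norm (\<phi> n f) \<le> C * Lp_norm p M f" by blast
  qed (use G_Lp \<phi>_add \<phi>_cmult conv in auto)
  moreover have "\<forall>n. \<forall>x\<in>space M. norm (G n x) = 1" using v1 by (auto simp: G_def split: prod.splits)
  ultimately show ?thesis by blast
qed

end

section \<open>Closed span of a martingale difference system\<close>

context martingale_difference_system begin

definition closed_span :: "('a \<Rightarrow> complex) set" where
  "closed_span = {f \<in> Lp_space p M.
     \<forall>e>0. \<exists>n a. Lp_norm p M (\<lambda>x. f x - (\<Sum>k<n. a k * of_real (h k x))) < e}"

lemma closed_span_Lp: "f \<in> closed_span \<Longrightarrow> f \<in> Lp_space p M"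
  by (simp add: closed_span_def)

lemma closed_span_limit:
  assumes f: "f \<in> Lp_space p M" and close: "\<And>e. 0 < e \<Longrightarrow> \<exists>g\<in>closed_span. Lp_norm p M (\<lambda>x. f x - g x) < e"
  shows "f \<in> closed_span"
  unfolding closed_span_def
proof (intro CollectI conjI f allI impI)
  fix e :: real assume "0 < e"
  then have e: "0 < e / 2" by simp
  obtain g where g: "g \<in> closed_span" and fg: "Lp_norm p M (\<lambda>x. f x - g x) < e / 2" using close[OF e] by blast
  obtain n a where "Lp_norm p M (\<lambda>x. g x - (\<Sum>k<n. a k * of_real (h k x))) < e / 2"
    using g e unfolding closed_span_def by blast
  with fg Lp_norm_diff_triangle[OF f closed_span_Lp[OF g] Lp_sum_h[of a "{..<n}"]]
  show "\<exists>n a. Lp_norm p M (\<lambda>x. f x - (\<Sum>k<n. a k * of_real (h k x))) < e"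
    by (intro exI[of _ n] exI[of _ a]) simp
qed

lemma finite_combination_in_closed_span: "(\<lambda>x. \<Sum>k<n. a k * of_real (h k x)) \<in> closed_span"
  unfolding closed_span_def
proof (intro CollectI conjI Lp_sum_h allI impI)
  fix e :: real assume "0 < e"
  then show "\<exists>m b. Lp_norm p M (\<lambda>x. (\<Sum>k<n. a k * of_real (h k x)) - (\<Sum>k<m. b k * of_real (h k x))) < e"
    by (intro exI[of _ n] exI[of _ a]) (simp add: Lp_norm_AE_zero)
qed

lemma closed_span_add:
  assumes f: "f \<in> closed_span" and g: "g \<in> closed_span"
  shows "(\<lambda>x. f x + g x) \<in> closed_span"
proof (rule closed_span_limit)
  show "(\<lambda>x. f x + g x) \<in> Lp_space p M" using f g by (intro Lp_add closed_span_Lp)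
  fix e :: real assume "0 < e"
  then have e: "0 < e / 2" by simp
  obtain n a where a: "Lp_norm p M (\<lambda>x. f x - (\<Sum>k<n. a k * of_real (h k x))) < e / 2"
    using f e unfolding closed_span_def by blast
  obtain m b where b: "Lp_norm p M (\<lambda>x. g x - (\<Sum>k<m. b k * of_real (h k x))) < e / 2"
    using g e unfolding closed_span_def by blast
  define c where "c k = (if k < n then a k else 0) + (if k < m then b k else 0)" for k
  have pad: "(\<Sum>k<n. a k * of_real (h k x)) = (\<Sum>k<max n m. (if k < n then a k else 0) * of_real (h k x))"
    for n m :: nat and a :: "nat \<Rightarrow> complex" and x by (rule sum.mono_neutral_cong_left) auto
  have c: "(\<Sum>k<max n m. c k * of_real (h k x)) = (\<Sum>k<n. a k * of_real (h k x)) + (\<Sum>k<m. b k * of_real (h k x))" for x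
    using pad[of a x n m] pad[of b x m n] by (simp add: c_def distrib_right sum.distrib max.commute)
  have "Lp_norm p M (\<lambda>x. (f x - (\<Sum>k<n. a k * of_real (h k x))) + (g x - (\<Sum>k<m. b k * of_real (h k x))))
     \<le> Lp_norm p M (\<lambda>x. f x - (\<Sum>k<n. a k * of_real (h k x))) + Lp_norm p M (\<lambda>x. g x - (\<Sum>k<m. b k * of_real (h k x)))"
    using f g by (intro Lp_norm_triangle Lp_diff Lp_sum_h closed_span_Lp)
  also have "\<dots> < e" using a b by simp
  finally have "Lp_norm p M (\<lambda>x. f x + g x - (\<Sum>k<max n m. c k * of_real (h k x))) < e"
    unfolding c by (simp add: algebra_simps)
  then show "\<exists>q\<in>closed_span. Lp_norm p M (\<lambda>x. f x + g x - q x) < e"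
    by (rule bexI[OF _ finite_combination_in_closed_span])
qed

lemma closed_span_cmult:
  assumes f: "f \<in> closed_span"
  shows "(\<lambda>x. c * f x) \<in> closed_span"
proof (rule closed_span_limit)
  show "(\<lambda>x. c * f x) \<in> Lp_space p M" using f by (intro Lp_cmult closed_span_Lp)
  fix e :: real assume "0 < e"
  then have e: "0 < e / (norm c + 1)" by (simp add: add_nonneg_pos)
  then obtain n a where a: "Lp_norm p M (\<lambda>x. f x - (\<Sum>k<n. a k * of_real (h k x))) < e / (norm c + 1)"
    using f unfolding closed_span_def by blast
  have "Lp_norm p M (\<lambda>x. c * f x - (\<Sum>k<n. (c * a k) * of_real (h k x))) =
      Lp_norm p M (\<lambda>x. c * (f x - (\<Sum>k<n. a k * of_real (h k x))))"
    by (simp add: sum_distrib_left right_diff_distrib mult.assoc)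
  also have "\<dots> \<le> (norm c + 1) * Lp_norm p M (\<lambda>x. f x - (\<Sum>k<n. a k * of_real (h k x)))"
    unfolding Lp_norm_cmult by (intro mult_right_mono Lp_norm_nonneg) simp
  also have "\<dots> < e" using a by (simp add: pos_less_divide_eq add_nonneg_pos mult.commute)
  finally show "\<exists>q\<in>closed_span. Lp_norm p M (\<lambda>x. c * f x - q x) < e"
    by (rule bexI[OF _ finite_combination_in_closed_span])
qed

lemma closed_span_cong_AE:
  assumes g: "g \<in> closed_span" and f: "f \<in> Lp_space p M" and eq: "AE x in M. f x = g x"
  shows "f \<in> closed_span"
proof (rule closed_span_limit[OF f])
  fix e :: real assume "0 < e"
  moreover have "Lp_norm p M (\<lambda>x. f x - g x) = 0"
    using eq by (intro Lp_norm_AE_zero) auto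
  ultimately show "\<exists>g\<in>closed_span. Lp_norm p M (\<lambda>x. f x - g x) < e"
    using g by (intro bexI[of _ g]) simp_all
qed

lemma closed_span_sum:
  assumes "\<And>i. i \<in> I \<Longrightarrow> f i \<in> closed_span"
  shows "(\<lambda>x. \<Sum>i\<in>I. f i x) \<in> closed_span"
proof -
  have zero: "(\<lambda>x. 0) \<in> closed_span" using finite_combination_in_closed_span[of _ 0] by simp
  show ?thesis using assms
    by (induction I rule: infinite_finite_induct) (auto intro: closed_span_add zero)
qed

lemma Lp_indicator:
  assumes [measurable]: "E \<in> sets M"
  shows "(\<lambda>x. of_real (indicator E x)) \<in> Lp_space p M"
proof (rule Lp_bounded[where B = 1])
  show "(\<lambda>x. of_real (indicator E x) :: complex) \<in> borel_measurable M" by measurable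
qed (simp add: indicator_def)

lemma closed_span_indicator_limit:
  assumes E: "E \<in> sets M"
    and approx: "\<And>e. 0 < e \<Longrightarrow> \<exists>F\<in>sets M. (\<lambda>x. of_real (indicator F x)) \<in> closed_span \<and> measure M (sym_diff E F) < e"
  shows "(\<lambda>x. of_real (indicator E x)) \<in> closed_span"
proof (rule closed_span_limit[OF Lp_indicator[OF E]])
  fix e :: real assume e: "0 < e"
  then have "0 < (e / 2) powr p" by simp
  then obtain F where F: "F \<in> sets M" "(\<lambda>x. of_real (indicator F x)) \<in> closed_span"
    and small: "measure M (sym_diff E F) < (e / 2) powr p" using approx by blast
  have "(LINT x|M. norm (complex_of_real (indicator E x) - of_real (indicator F x)) powr p) = (LINT x|M. indicator (sym_diff E F) x)"
    by (intro Bochner_Integration.integral_cong) (auto simp: indicator_def)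
  also have "\<dots> = measure M (sym_diff E F)" using E F by simp
  finally have "Lp_norm p M (\<lambda>x. of_real (indicator E x) - of_real (indicator F x)) \<le> e / 2"
    using small e by (intro Lp_norm_leI) auto
  then have "Lp_norm p M (\<lambda>x. of_real (indicator E x) - of_real (indicator F x)) < e" using e by linarith
  then show "\<exists>g\<in>closed_span. Lp_norm p M (\<lambda>x. of_real (indicator E x) - g x) < e"
    using F(2) by (rule bexI)
qed

text \<open>
  Every \<open>L\<^sup>p\<close> function is a limit of simple functions, by dominated convergence.
\<close>

lemma closed_span_eq_Lp:
  assumes ind: "\<And>E. E \<in> sets M \<Longrightarrow> (\<lambda>x. of_real (indicator E x)) \<in> closed_span"
  shows "closed_span = Lp_space p M"
proof (intro equalityI subsetI)
  fix f assume f: "f \<in> Lp_space p M"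
  obtain F where F: "\<And>i. simple_function M (F i)"
    and lim: "\<And>x. x \<in> space M \<Longrightarrow> (\<lambda>i. F i x) \<longlonglongrightarrow> f x"
    and dom: "\<And>i x. x \<in> space M \<Longrightarrow> dist (F i x) 0 \<le> 2 * dist (f x) 0"
    using borel_measurable_implies_sequence_metric[OF Lp_measurable[OF f], of 0] by blast
  have F_meas [measurable]: "F i \<in> borel_measurable M" for i using F by (rule borel_measurable_simple_function)
  have [measurable]: "f \<in> borel_measurable M" using f by (rule Lp_measurable)
  have simple: "F i \<in> closed_span" for i
  proof (rule closed_span_cong_AE)
    show "(\<lambda>x. \<Sum>y\<in>F i ` space M. y * of_real (indicator (F i -` {y} \<inter> space M) x)) \<in> closed_span"
      using simple_functionD[OF F] by (intro closed_span_sum closed_span_cmult ind) auto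
    show "F i \<in> Lp_space p M"
    proof (rule Lp_space_dominated[OF F_meas])
      show "integrable M (\<lambda>x. norm (2 * f x) powr p)"
        using Lp_integrable_powr[OF Lp_cmult[OF f]] .
      show "norm (F i x) powr p \<le> norm (2 * f x) powr p" if "x \<in> space M" for x
        using dom[OF that, of i] p_gt_1 by (intro powr_mono2) (auto simp: norm_mult)
    qed
    show "AE x in M. F i x = (\<Sum>y\<in>F i ` space M. y * of_real (indicator (F i -` {y} \<inter> space M) x))"
    proof (rule AE_I2)
      fix x assume "x \<in> space M"
      with F have "F i x = (\<Sum>y\<in>F i ` space M. indicator (F i -` {y} \<inter> space M) x *\<^sub>R y)"
        by (rule simple_function_indicator_representation_banach)
      also have "\<dots> = (\<Sum>y\<in>F i ` space M. y * of_real (indicator (F i -` {y} \<inter> space M) x))"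
        by (intro sum.cong refl) (simp add: scaleR_conv_of_real)
      finally show "F i x = \<dots>" .
    qed
  qed
  show "f \<in> closed_span"
  proof (rule closed_span_limit[OF f])
    fix e :: real assume e: "0 < e"
    have "(\<lambda>i. LINT x|M. norm (f x - F i x) powr p) \<longlonglongrightarrow> (LINT x|M. 0)"
    proof (rule integral_dominated_convergence)
      show "integrable M (\<lambda>x. norm (3 * f x) powr p)"
        using Lp_integrable_powr[OF Lp_cmult[OF f]] .
      show "AE x in M. (\<lambda>i. norm (f x - F i x) powr p) \<longlonglongrightarrow> 0"
      proof (rule AE_I2)
        fix x assume "x \<in> space M"
        then have "(\<lambda>i. norm (f x - F i x)) \<longlonglongrightarrow> norm (f x - f x)" using lim by (intro tendsto_intros)
        then show "(\<lambda>i. norm (f x - F i x) powr p) \<longlonglongrightarrow> 0"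
          using p_gt_1 by (intro tendsto_zero_powrI[where b = p]) auto
      qed
      show "AE x in M. norm (norm (f x - F i x) powr p) \<le> norm (3 * f x) powr p" for i
      proof (rule AE_I2)
        fix x assume "x \<in> space M"
        then have "norm (f x - F i x) \<le> norm (3 * f x)"
          using dom[of x i] norm_triangle_ineq4[of "f x" "F i x"] by (simp add: norm_mult)
        then show "norm (norm (f x - F i x) powr p) \<le> norm (3 * f x) powr p"
          using p_gt_1 by (simp add: powr_mono2)
      qed
    qed auto
    then have "\<forall>\<^sub>F i in sequentially. (LINT x|M. norm (f x - F i x) powr p) < (e / 2) powr p"
      using e by (intro order_tendstoD(2)) auto
    then obtain i where "(LINT x|M. norm (f x - F i x) powr p) < (e / 2) powr p"
      by (auto simp: eventually_sequentially)
    then have "Lp_norm p M (\<lambda>x. f x - F i x) \<le> e / 2" using e by (intro Lp_norm_leI) auto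
    then have "Lp_norm p M (\<lambda>x. f x - F i x) < e" using e by linarith
    then show "\<exists>g\<in>closed_span. Lp_norm p M (\<lambda>x. f x - g x) < e" using simple by blast
  qed
qed (rule closed_span_Lp)

end

section \<open>Haar systems of binary partitions\<close>

text \<open>
  The cells form a binary tree numbered like a heap: the root has number \<open>1\<close> and the children of the
  cell with number \<open>k\<close> have the numbers \<open>2 * k\<close> and \<open>2 * k + 1\<close>. The value \<open>cell_index B n x\<close> is the
  number of the cell of depth \<open>n\<close> that contains \<open>x\<close>; cells of depth \<open>n\<close> are split by \<open>B n\<close>. The numbers
  increase with the depth, which orders the Haar functions as a sequence.
\<close>

fun cell_index :: "(nat \<Rightarrow> 'a set) \<Rightarrow> nat \<Rightarrow> 'a \<Rightarrow> nat" where
  "cell_index B 0 x = 1"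
| "cell_index B (Suc n) x = 2 * cell_index B n x + (if x \<in> B n then 0 else 1)"

definition cell :: "'a measure \<Rightarrow> (nat \<Rightarrow> 'a set) \<Rightarrow> nat \<Rightarrow> 'a set" where
  "cell M B k = {x \<in> space M. \<exists>n. cell_index B n x = k}"

text \<open>
  The values \<open>b / (a + b)\<close> and \<open>- a / (a + b)\<close> on the children of measures \<open>a\<close> and \<open>b\<close> give mean zero
  and absolute value at most \<open>1\<close>. If one child is a null set, the function vanishes almost everywhere.
\<close>

definition haar :: "'a measure \<Rightarrow> (nat \<Rightarrow> 'a set) \<Rightarrow> nat \<Rightarrow> 'a \<Rightarrow> real" where
  "haar M B k x = (if k = 0 then 1 else
     let a = measure M (cell M B (2 * k)); b = measure M (cell M B (2 * k + 1))
     in b / (a + b) * indicator (cell M B (2 * k)) x - a / (a + b) * indicator (cell M B (2 * k + 1)) x)"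

lemma cell_index_pos: "0 < cell_index B n x"
  by (induction n) auto

text \<open>
  A heap number determines the depth of its cell and, by repeated halving, the numbers of all ancestors.
\<close>

lemma cell_index_determines_history:
  "cell_index B n x = cell_index B m y \<Longrightarrow> n = m \<and> (\<forall>l\<le>n. cell_index B l x = cell_index B l y)"
proof (induction n arbitrary: m)
  case 0
  have "m = 0"
  proof (cases m)
    case (Suc m')
    with 0 cell_index_pos[of B m' y] show ?thesis by simp
  qed simp
  then show ?case by simp
next
  case (Suc n)
  show ?case
  proof (cases m)
    case 0
    with Suc cell_index_pos[of B n x] show ?thesis by simp
  next
    case m: (Suc m')
    have "cell_index B (Suc n) x div 2 = cell_index B n x" "cell_index B (Suc m') y div 2 = cell_index B m' y" by auto
    then have "cell_index B n x = cell_index B m' y" using Suc.prems m by metis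
    with Suc.IH[OF this] Suc.prems m show ?thesis by (auto simp: le_Suc_eq)
  qed
qed

lemma cell_index_mono: "n \<le> m \<Longrightarrow> cell_index B n x \<le> cell_index B m x"
proof (induction m rule: dec_induct)
  case (step m)
  have "cell_index B m x \<le> cell_index B (Suc m) x" by simp
  with step.IH show ?case by (rule le_trans)
qed simp

lemma finite_range_cell_index: "finite (range (cell_index B n))"
proof (induction n)
  case (Suc n)
  have "range (cell_index B (Suc n)) \<subseteq> (\<lambda>c. 2 * c) ` range (cell_index B n) \<union> (\<lambda>c. 2 * c + 1) ` range (cell_index B n)"
    by auto
  then show ?case using Suc finite_subset by blast
qed (simp add: image_constant_conv)

lemma cell_children: "1 \<le> k \<Longrightarrow> x \<in> space M \<Longrightarrow> j < 2 \<Longrightarrow>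
   x \<in> cell M B (2 * k + j) \<longleftrightarrow> (\<exists>n. cell_index B n x = k \<and> (x \<in> B n \<longleftrightarrow> j = 0))"
proof -
  assume k: "1 \<le> k" and x: "x \<in> space M" and j: "j < 2"
  show ?thesis
  proof
    assume "x \<in> cell M B (2 * k + j)"
    then obtain m where m: "cell_index B m x = 2 * k + j" by (auto simp: cell_def)
    with k obtain n where n: "m = Suc n" by (cases m) auto
    have "j = 0 \<or> j = 1" using j by auto
    then have "cell_index B n x = k \<and> (x \<in> B n \<longleftrightarrow> j = 0)" using m n by (auto split: if_splits) presburger+
    then show "\<exists>n. cell_index B n x = k \<and> (x \<in> B n \<longleftrightarrow> j = 0)" by blast
  next
    assume "\<exists>n. cell_index B n x = k \<and> (x \<in> B n \<longleftrightarrow> j = 0)"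
    then obtain n where "cell_index B n x = k" "x \<in> B n \<longleftrightarrow> j = 0" by blast
    then have "cell_index B (Suc n) x = 2 * k + j" using j by auto
    then show "x \<in> cell M B (2 * k + j)" using x unfolding cell_def by blast
  qed
qed

lemma cell_split:
  assumes "1 \<le> k"
  shows "cell M B (2 * k) \<union> cell M B (2 * k + 1) = cell M B k" "cell M B (2 * k) \<inter> cell M B (2 * k + 1) = {}"
proof -
  have sub: "x \<in> space M" if "x \<in> cell M B j" for x j using that by (auto simp: cell_def)
  have c: "x \<in> cell M B (2 * k) \<longleftrightarrow> x \<in> space M \<and> (\<exists>n. cell_index B n x = k \<and> x \<in> B n)"
       "x \<in> cell M B (2 * k + 1) \<longleftrightarrow> x \<in> space M \<and> (\<exists>n. cell_index B n x = k \<and> x \<notin> B n)" for x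
    using cell_children[OF assms, of x M 0 B] cell_children[OF assms, of x M 1 B] sub[of x] by auto
  show "cell M B (2 * k) \<union> cell M B (2 * k + 1) = cell M B k"
    unfolding set_eq_iff Un_iff c by (auto simp: cell_def)
  have "n = m" if "cell_index B n x = cell_index B m x" for n m x using cell_index_determines_history[OF that] by blast
  then show "cell M B (2 * k) \<inter> cell M B (2 * k + 1) = {}" unfolding set_eq_iff Int_iff c by blast
qed

text \<open>
  A child of a cell with a smaller number than \<open>k\<close> cannot separate two points of the cell with number
  \<open>k\<close>: if one of them lies in it, then it is an ancestor of that cell or that cell itself.
\<close>

lemma cell_constant:
  assumes xy: "x \<in> cell M B k" "y \<in> cell M B k" and "1 \<le> j" "j < k" and c: "c = 2 * j \<or> c = 2 * j + 1" and x: "x \<in> cell M B c"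
  shows "y \<in> cell M B c"
proof -
  obtain n n' where n: "cell_index B n x = k" "cell_index B n' y = k" using xy by (auto simp: cell_def)
  then have hist: "\<forall>l\<le>n. cell_index B l x = cell_index B l y" using cell_index_determines_history[of B n x n' y] by simp
  obtain m where m: "cell_index B m x = c" using x by (auto simp: cell_def)
  then obtain m' where m': "m = Suc m'" using c \<open>1 \<le> j\<close> by (cases m) auto
  have "cell_index B m' x = j" using m m' c by (auto split: if_splits)
  have "m' < n"
  proof (rule ccontr)
    assume "\<not> m' < n"
    then have "cell_index B n x \<le> cell_index B m' x" by (intro cell_index_mono) auto
    with \<open>cell_index B m' x = j\<close> n \<open>j < k\<close> show False by simp
  qed
  then have "cell_index B (Suc m') x = cell_index B (Suc m') y" using hist by (simp del: cell_index.simps)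
  then have "cell_index B m y = c" using m m' by (simp del: cell_index.simps)
  then show ?thesis using xy(2) by (auto simp: cell_def)
qed

lemma haar_nonzero_cell:
  assumes "haar M B k x \<noteq> 0" "0 < k"
  shows "x \<in> cell M B k"
  using assms cell_split(1)[of k M B] by (auto simp: haar_def Let_def indicator_def split: if_splits)

text \<open>
  The density assumption says that finite unions of the sets \<open>B n\<close> are dense in the measure algebra.
\<close>

locale separating_sequence = Lp_finite_measure M p for M :: "'a measure" and p +
  fixes B :: "nat \<Rightarrow> 'a set"
  assumes B_sets [measurable]: "\<And>n. B n \<in> sets M"
    and B_dense: "\<And>E e. E \<in> sets M \<Longrightarrow> 0 < e \<Longrightarrow> \<exists>J. finite J \<and> measure M (sym_diff E (\<Union>j\<in>J. B j)) < e"
begin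

lemma cell_index_measurable [measurable]: "cell_index B n \<in> measurable M (count_space UNIV)"
  by (induction n) (simp_all, measurable)

lemma cell_sets [measurable]: "cell M B k \<in> sets M"
  unfolding cell_def by measurable

lemma haar_measurable [measurable]: "haar M B k \<in> borel_measurable M"
  unfolding haar_def Let_def by measurable

sublocale martingale_difference_system M p "haar M B"
proof
  fix k x y j
  show "haar M B k \<in> borel_measurable M" by (rule haar_measurable)
  show "\<bar>haar M B k x\<bar> \<le> 1"
  proof -
    have "\<bar>a / (a + b)\<bar> \<le> 1" "\<bar>b / (a + b)\<bar> \<le> 1" if "0 \<le> a" "0 \<le> b" for a b :: real
    proof -
      have "0 < a + b \<or> a + b = 0" using that by linarith
      then show "\<bar>a / (a + b)\<bar> \<le> 1" "\<bar>b / (a + b)\<bar> \<le> 1"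
        using that by (simp_all add: divide_le_eq_1)
    qed
    moreover have "x \<notin> cell M B (2 * k) \<or> x \<notin> cell M B (2 * k + 1)" if "0 < k" using cell_split(2)[of k M B] that by auto
    ultimately show ?thesis by (auto simp: haar_def Let_def indicator_def)
  qed
  show "haar M B 0 x = 1" by (simp add: haar_def)
  show "(LINT x|M. haar M B k x) = 0" if "0 < k"
  proof -
    have int: "(LINT x|M. c * indicator A x - d * indicator A' x) = c * measure M A - d * measure M A'"
      if "A \<in> sets M" "A' \<in> sets M" for c d :: real and A A'
      using that by (subst Bochner_Integration.integral_diff) (simp_all add: emeasure_eq_measure)
    have "\<not> k = 0" using that by simp
    then show ?thesis
      unfolding haar_def Let_def by (simp only: if_False int[OF cell_sets cell_sets]) simp
  qed
  assume jk: "j < k" and "x \<in> space M" "y \<in> space M" "haar M B k x \<noteq> 0" "haar M B k y \<noteq> 0"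
  then have xy: "x \<in> cell M B k" "y \<in> cell M B k" using haar_nonzero_cell by fastforce+
  show "haar M B j x = haar M B j y"
  proof (cases "j = 0")
    case False
    then have j: "1 \<le> j" by simp
    have "x \<in> cell M B c \<longleftrightarrow> y \<in> cell M B c" if "c = 2 * j \<or> c = 2 * j + 1" for c
      using cell_constant[OF xy j jk that] cell_constant[OF xy(2,1) j jk that] by blast
    then show ?thesis by (simp add: haar_def Let_def indicator_def)
  qed (simp add: haar_def)
qed

text \<open>
  The indicator of a child is a multiple of the indicator of its parent plus or minus the Haar function
  of the parent, so one can descend from the root. If the parent is a null set, the indicator is zero
  almost everywhere.
\<close>

lemma cell_in_closed_span: "1 \<le> k \<Longrightarrow> (\<lambda>x. of_real (indicator (cell M B k) x)) \<in> closed_span"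
proof (induction k rule: less_induct)
  case (less k)
  show ?case
  proof (cases "k = 1")
    case True
    have "cell M B 1 = space M" by (auto simp: cell_def intro: exI[of _ 0])
    then have "of_real (indicator (cell M B k) x) = (\<Sum>k<1. 1 * complex_of_real (haar M B k x))" if "x \<in> space M" for x
      using True that by (simp add: haar_def)
    then show ?thesis
      by (intro closed_span_cong_AE[OF finite_combination_in_closed_span[of "\<lambda>_. 1" 1]] Lp_indicator) auto
  next
    case False
    define j where "j = k div 2"
    have j: "1 \<le> j" "j < k" using False less.prems by (auto simp: j_def)
    define a b where "a = measure M (cell M B (2 * j))" and "b = measure M (cell M B (2 * j + 1))"
    have haar_eq: "haar M B j x = b / (a + b) * indicator (cell M B (2 * j)) x - a / (a + b) * indicator (cell M B (2 * j + 1)) x" for x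
      using j by (simp add: haar_def a_def b_def Let_def)
    have ab: "a \<ge> 0" "b \<ge> 0" by (auto simp: a_def b_def)
    have h_in: "(\<lambda>x. complex_of_real (haar M B j x)) \<in> closed_span"
      using finite_combination_in_closed_span[of "\<lambda>i. if i = j then 1 else 0" "Suc j"]
      by (simp add: if_distrib[of "\<lambda>c. c * _"] cong: if_cong)
    have null: "AE x in M. x \<notin> cell M B k" if "a + b = 0" "k = 2 * j \<or> k = 2 * j + 1"
    proof -
      have "a = 0" "b = 0" using that(1) ab by linarith+
      then have "measure M (cell M B k) = 0" using that(2) unfolding a_def b_def by auto
      then have "cell M B k \<in> null_sets M" by (auto simp: null_sets_def emeasure_eq_measure)
      then show ?thesis by (rule AE_not_in)
    qed
    have ind: "indicator (cell M B j) x = indicator (cell M B (2 * j)) x + (indicator (cell M B (2 * j + 1)) x :: real)" for x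
      using cell_split[OF j(1), of M B] by (auto simp: indicator_def)
    have weights: "b / (a + b) = 1 - a / (a + b)" if "a + b \<noteq> 0"
      using that by (simp add: field_simps)
    have "k = 2 * j \<or> k = 2 * j + 1" by (auto simp: j_def)
    then have "\<exists>c d :: real. AE x in M. indicator (cell M B k) x = c * indicator (cell M B j) x + d * haar M B j x"
    proof
      assume k: "k = 2 * j"
      have "AE x in M. indicator (cell M B k) x = a / (a + b) * indicator (cell M B j) x + 1 * haar M B j x"
      proof (cases "a + b = 0")
        case True
        from null[OF True] k have "AE x in M. x \<notin> cell M B k" by simp
        then show ?thesis by eventually_elim (simp add: True haar_eq)
      next
        case False
        have "indicator (cell M B k) x = a / (a + b) * indicator (cell M B j) x + 1 * haar M B j x" for x
          unfolding haar_eq ind k weights[OF False] by (simp add: algebra_simps)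
        then show ?thesis by simp
      qed
      then show ?thesis by blast
    next
      assume k: "k = 2 * j + 1"
      have "AE x in M. indicator (cell M B k) x = b / (a + b) * indicator (cell M B j) x + (- 1) * haar M B j x"
      proof (cases "a + b = 0")
        case True
        from null[OF True] k have "AE x in M. x \<notin> cell M B k" by simp
        then show ?thesis by eventually_elim (simp add: True haar_eq)
      next
        case False
        have "indicator (cell M B k) x = b / (a + b) * indicator (cell M B j) x + (- 1) * haar M B j x" for x
          unfolding haar_eq ind k weights[OF False] by (simp add: algebra_simps)
        then show ?thesis by simp
      qed
      then show ?thesis by blast
    qed
    then obtain c d :: real where cd: "AE x in M. indicator (cell M B k) x = c * indicator (cell M B j) x + d * haar M B j x" by blast
    show ?thesis
    proof (rule closed_span_cong_AE)
      show "(\<lambda>x. complex_of_real c * of_real (indicator (cell M B j) x) + of_real d * of_real (haar M B j x)) \<in> closed_span"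
        using less.IH[of j] j by (intro closed_span_add closed_span_cmult h_in) auto
      show "AE x in M. of_real (indicator (cell M B k) x) = complex_of_real c * of_real (indicator (cell M B j) x) + of_real d * of_real (haar M B j x)"
        using cd by eventually_elim simp
    qed (auto intro: Lp_indicator)
  qed
qed

text \<open>
  A union of sets \<open>B j\<close> with \<open>j < n\<close> is a disjoint union of cells of depth \<open>n\<close>.
\<close>

lemma finite_union_in_closed_span:
  assumes "finite J"
  shows "(\<lambda>x. of_real (indicator (\<Union>j\<in>J. B j) x)) \<in> closed_span"
proof -
  define E where "E = (\<Union>j\<in>J. B j)"
  have E: "E \<in> sets M" "E \<subseteq> space M" unfolding E_def using assms sets.sets_into_space[OF B_sets] by auto
  obtain n where n: "J \<subseteq> {..<n}" using finite_nat_bounded[OF assms] by blast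
  define S where "S = cell_index B n ` E"
  have S: "finite S" unfolding S_def by (rule finite_subset[OF _ finite_range_cell_index[of B n]]) auto
  have S1: "1 \<le> k" if "k \<in> S" for k using that cell_index_pos[of B n] by (force simp: S_def Suc_le_eq)
  have "E = (\<Union>k\<in>S. cell M B k)"
  proof (intro equalityI subsetI)
    fix x assume "x \<in> E"
    then show "x \<in> (\<Union>k\<in>S. cell M B k)" using E(2) by (auto simp: S_def cell_def)
  next
    fix y assume "y \<in> (\<Union>k\<in>S. cell M B k)"
    then obtain x m where x: "x \<in> E" and m: "cell_index B m y = cell_index B n x" by (auto simp: S_def cell_def)
    obtain j where j: "j \<in> J" "x \<in> B j" using x by (auto simp: E_def)
    have "j < n" using j n by auto
    then have "cell_index B (Suc j) y = cell_index B (Suc j) x" "cell_index B j y = cell_index B j x"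
      using cell_index_determines_history[OF m] by (simp_all del: cell_index.simps)
    then have "y \<in> B j" using j by (auto split: if_splits)
    then show "y \<in> E" using j by (auto simp: E_def)
  qed
  moreover have "disjoint_family_on (cell M B) S"
  proof (unfold disjoint_family_on_def, intro ballI impI)
    fix k l assume "k \<in> S" "l \<in> S" "k \<noteq> l"
    have "\<exists>m. k' = cell_index B n m" if "k' \<in> S" for k' using that by (auto simp: S_def)
    then obtain u v where u: "k = cell_index B n u" "l = cell_index B n v" using \<open>k \<in> S\<close> \<open>l \<in> S\<close> by metis
    show "cell M B k \<inter> cell M B l = {}"
    proof (rule ccontr)
      assume "cell M B k \<inter> cell M B l \<noteq> {}"
      then obtain x i i' where "cell_index B i x = k" "cell_index B i' x = l" by (auto simp: cell_def)
      then have "i = n" "i' = n" using u cell_index_determines_history[of B i x n u] cell_index_determines_history[of B i' x n v] by auto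
      then show False using \<open>cell_index B i x = k\<close> \<open>cell_index B i' x = l\<close> \<open>k \<noteq> l\<close> by simp
    qed
  qed
  ultimately have "complex_of_real (indicator E x) = (\<Sum>k\<in>S. of_real (indicator (cell M B k) x))" for x
    using indicator_UN_disjoint[OF S, of "cell M B" x, where 'c = real] by (simp flip: of_real_sum)
  then show ?thesis unfolding E_def[symmetric]
    using closed_span_sum[of S "\<lambda>k x. of_real (indicator (cell M B k) x)"] cell_in_closed_span S1 by simp
qed

lemma haar_dense:
  assumes "f \<in> Lp_space p M" "0 < e"
  shows "\<exists>n a. Lp_norm p M (\<lambda>x. f x - (\<Sum>k<n. a k * of_real (haar M B k x))) < e"
proof -
  have "closed_span = Lp_space p M"
  proof (intro closed_span_eq_Lp closed_span_indicator_limit)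
    fix E e assume "E \<in> sets M" "(0 :: real) < e"
    then obtain J where J: "finite J" "measure M (sym_diff E (\<Union>j\<in>J. B j)) < e" using B_dense by blast
    moreover have "(\<Union>j\<in>J. B j) \<in> sets M" using J by auto
    ultimately show "\<exists>F\<in>sets M. (\<lambda>x. of_real (indicator F x)) \<in> closed_span \<and> measure M (sym_diff E F) < e"
      using finite_union_in_closed_span by blast
  qed
  with assms show ?thesis unfolding closed_span_def by blast
qed

end

section \<open>Lebesgue measure on a set of finite measure\<close>

text \<open>
  Outer regularity reduces the approximation to open sets, and an open set is the increasing limit of
  finite unions of the members of a countable basis that it contains.
\<close>

lemma lebesgue_separating_sequence:
  fixes \<Omega> :: "'a::euclidean_space set"
  assumes \<Omega>: "\<Omega> \<in> sets lebesgue" and fin: "emeasure lebesgue \<Omega> < \<infinity>"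
  obtains B where "\<And>n::nat. B n \<in> sets (lebesgue_on \<Omega>)"
    "\<And>E e. E \<in> sets (lebesgue_on \<Omega>) \<Longrightarrow> 0 < e \<Longrightarrow>
        \<exists>J. finite J \<and> measure (lebesgue_on \<Omega>) (sym_diff E (\<Union>j\<in>J. B j)) < e"
proof -
  interpret finite_measure "lebesgue_on \<Omega>"
    using \<Omega> fin by (intro finite_measureI) (simp add: emeasure_restrict_space)
  obtain \<B> :: "'a set set" where \<B>: "countable \<B>" "topological_basis \<B>" using ex_countable_basis by blast
  have ne: "\<B> \<noteq> {}"
  proof
    assume "\<B> = {}"
    then have "open {} \<and> (UNIV :: 'a set) = {}" using topological_basisE[OF \<B>(2), of UNIV] by blast
    then show False by simp
  qed
  define U where "U = from_nat_into \<B>"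
  have U: "range U = \<B>" unfolding U_def using range_from_nat_into[OF ne \<B>(1)] .
  have U_open: "open (U n)" for n using U \<B>(2) by (metis rangeI topological_basis_open)
  have sets_iff: "A \<in> sets (lebesgue_on \<Omega>) \<longleftrightarrow> A \<subseteq> \<Omega> \<and> A \<in> sets lebesgue" for A
    using \<Omega> by (subst sets_restrict_space_iff) auto
  show ?thesis
  proof (rule that[of "\<lambda>n. U n \<inter> \<Omega>"])
    have U_leb: "U n \<in> sets lebesgue" for n using U_open by (simp add: borel_open sets_completionI_sets)
    show "U n \<inter> \<Omega> \<in> sets (lebesgue_on \<Omega>)" for n unfolding sets_iff using U_leb \<Omega> by auto
    fix E :: "'a set" and e :: real assume E: "E \<in> sets (lebesgue_on \<Omega>)" and e: "0 < e"
    obtain T where T: "open T" "E \<subseteq> T" "T - E \<in> lmeasurable" "emeasure lebesgue (T - E) < ennreal (e / 2)"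
      using sets_lebesgue_outer_open[of E "e / 2"] E e sets_iff by auto
    define A where "A N = (\<Union>j\<in>{j. j < N \<and> U j \<subseteq> T}. U j \<inter> \<Omega>)" for N
    have A_sets: "A N \<in> sets (lebesgue_on \<Omega>)" for N
      unfolding A_def sets_iff using U_leb \<Omega> by (auto intro!: sets.finite_UN)
    have A_Un: "(\<Union>N. A N) = T \<inter> \<Omega>"
    proof (intro equalityI subsetI)
      fix x assume x: "x \<in> T \<inter> \<Omega>"
      then obtain V where "V \<in> \<B>" "x \<in> V" "V \<subseteq> T" using topological_basisE[OF \<B>(2) T(1)] by blast
      then obtain j where "x \<in> U j" "U j \<subseteq> T" using U by auto
      then have "x \<in> A (Suc j)" using x unfolding A_def by blast
      then show "x \<in> (\<Union>N. A N)" by blast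
    qed (auto simp: A_def)
    have T_sets: "T \<inter> \<Omega> \<in> sets (lebesgue_on \<Omega>)" using A_sets A_Un by (metis sets.countable_UN range_subsetD image_subset_iff)
    have "(\<lambda>N. measure (lebesgue_on \<Omega>) (A N)) \<longlonglongrightarrow> measure (lebesgue_on \<Omega>) (T \<inter> \<Omega>)"
      unfolding A_Un[symmetric]
    proof (rule finite_Lim_measure_incseq)
      show "range A \<subseteq> sets (lebesgue_on \<Omega>)" using A_sets by auto
      show "incseq A" unfolding incseq_def A_def by (intro allI impI UN_mono) auto
    qed
    then have "\<forall>\<^sub>F N in sequentially. measure (lebesgue_on \<Omega>) (T \<inter> \<Omega>) - e / 2 < measure (lebesgue_on \<Omega>) (A N)"
      using e by (intro order_tendstoD(1)) auto
    then obtain N where N: "measure (lebesgue_on \<Omega>) (T \<inter> \<Omega>) - e / 2 < measure (lebesgue_on \<Omega>) (A N)"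
      by (auto simp: eventually_sequentially)
    have AT: "A N \<subseteq> T \<inter> \<Omega>" using A_Un by blast
    have 1: "measure (lebesgue_on \<Omega>) (T \<inter> \<Omega> - A N) < e / 2"
      using N finite_measure_Diff[OF T_sets A_sets AT] by simp
    have 2: "measure (lebesgue_on \<Omega>) (T \<inter> \<Omega> - E) < e / 2"
    proof -
      have "emeasure (lebesgue_on \<Omega>) (T \<inter> \<Omega> - E) = emeasure lebesgue (T \<inter> \<Omega> - E)"
        using \<Omega> by (intro emeasure_restrict_space) auto
      also have "\<dots> \<le> emeasure lebesgue (T - E)" using T(3) by (intro emeasure_mono) auto
      also have "\<dots> < ennreal (e / 2)" by (rule T(4))
      finally show ?thesis by (simp add: emeasure_eq_measure ennreal_less_iff)
    qed
    have "measure (lebesgue_on \<Omega>) (sym_diff E (A N)) \<le> measure (lebesgue_on \<Omega>) ((T \<inter> \<Omega> - A N) \<union> (T \<inter> \<Omega> - E))"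
      using T_sets A_sets E AT T(2) by (intro finite_measure_mono) (auto simp: sets_iff)
    also have "\<dots> \<le> measure (lebesgue_on \<Omega>) (T \<inter> \<Omega> - A N) + measure (lebesgue_on \<Omega>) (T \<inter> \<Omega> - E)"
      using T_sets A_sets E by (intro measure_Un_le) auto
    also have "\<dots> < e" using 1 2 by simp
    finally show "\<exists>J. finite J \<and> measure (lebesgue_on \<Omega>) (sym_diff E (\<Union>j\<in>J. U j \<inter> \<Omega>)) < e"
      unfolding A_def by (intro exI[of _ "{j. j < N \<and> U j \<subseteq> T}"]) auto
  qed
qed

text \<open>
  The level sets of the norm are spheres, so the norm witnesses that the measure has no atoms.
\<close>

lemma norm_level_null:
  fixes \<Omega> :: "'a::euclidean_space set"
  assumes "\<Omega> \<in> sets lebesgue"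
  shows "AE x in lebesgue_on \<Omega>. norm x \<noteq> t"
proof -
  have "sphere (0 :: 'a) t \<in> null_sets lebesgue"
    using negligible_sphere[of 0 t] by (simp add: negligible_iff_null_sets)
  then have "AE x in lebesgue. x \<notin> sphere (0 :: 'a) t" by (rule AE_not_in)
  then have "AE x in lebesgue. x \<in> \<Omega> \<longrightarrow> norm x \<noteq> t" by eventually_elim auto
  then show ?thesis using assms by (subst AE_restrict_space_iff) auto
qed

theorem theorem1p1:
  fixes \<Omega> :: "(real ^ 'd) set" and p :: real
  assumes "\<Omega> \<in> sets lebesgue"
    and "0 < emeasure lebesgue \<Omega>"
    and "emeasure lebesgue \<Omega> < \<infinity>"
    and "1 < p"
  shows "\<exists>(g :: nat \<Rightarrow> real ^ 'd \<Rightarrow> complex) (g' :: nat \<Rightarrow> (real ^ 'd \<Rightarrow> complex) \<Rightarrow> complex).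
           unconditional_schauder_frame p (lebesgue_on \<Omega>) g g' \<and>
           (\<forall>n. AE x in lebesgue_on \<Omega>. norm (g n x) = 1)"
proof -
  obtain B where B: "\<And>n::nat. B n \<in> sets (lebesgue_on \<Omega>)"
    and B_dense: "\<And>E e. E \<in> sets (lebesgue_on \<Omega>) \<Longrightarrow> 0 < e \<Longrightarrow>
        \<exists>J. finite J \<and> measure (lebesgue_on \<Omega>) (sym_diff E (\<Union>j\<in>J. B j)) < e"
    using lebesgue_separating_sequence[OF assms(1,3)] by blast
  interpret finite_measure "lebesgue_on \<Omega>"
    using assms(1,3) by (intro finite_measureI) (simp add: emeasure_restrict_space)
  interpret separating_sequence "lebesgue_on \<Omega>" p B
    by unfold_locales (use assms(4) B B_dense in auto)
  interpret nonatomic_haar_like_system "lebesgue_on \<Omega>" p "haar (lebesgue_on \<Omega>) B" norm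
  proof unfold_locales
    show "norm \<in> borel_measurable (lebesgue_on \<Omega>)"
      by (intro continuous_imp_measurable_on_sets_lebesgue continuous_intros assms(1))
    show "AE x in lebesgue_on \<Omega>. norm x \<noteq> t" for t
      using norm_level_null[OF assms(1)] .
  qed (use haar_dense in auto)
  show ?thesis using unimodular_unconditional_frame by (blast intro: AE_I2)
qed

end
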